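(* Let $\mathfrak{P}$ be a compactness-like topological property and let $X$ and $Y$ be locally compact, locally-$\mathfrak{P}$ spaces, neither of which has $\mathfrak{P}$. If $(\mathscr{E}_\mathfrak{P}(X),\leq)$ and $(\mathscr{E}_\mathfrak{P}(Y),\leq)$ are order-isomorphic, then $\lambda_\mathfrak{P}X\setminus X$ and $\lambda_\mathfrak{P}Y\setminus Y$ are homeomorphic.
   Context: All spaces are completely regular Hausdorff; $\beta X$ is the Stone–Čech compactification. An extension of $X$ is a space containing $X$ as a dense subspace; its remainder is $Y\setminus X$. Extensions are identified up to homeomorphisms fixing $X$ pointwise, and $Y\leq Y'$ means there is a continuous map $Y'\to Y$ fixing $X$ pointwise. $\mathscr{E}_\mathfrak{P}(X)$ is the set of all extensions of $X$ with $\mathfrak{P}$ and compact remainder, ordered by $\leq$. $X$ is locally-$\mathfrak{P}$ if each point has an open neighborhood whose closure has $\mathfrak{P}$. $\mathrm{Coz}(X)$ is the set of cozero-sets of $X$. $\lambda_\mathfrak{P}X=\bigcup\{\mathrm{int}_{\beta X}\mathrm{cl}_{\beta X}C: C\in\mathrm{Coz}(X),\ \mathrm{cl}_XC\text{ has }\mathfrak{P}\}$. A topological property is compactness-like if it is hereditary to clopen subspaces, finitely additive (finite disjoint unions of closed subspaces with $\mathfrak{P}$ have $\mathfrak{P}$), invariant and inverse invariant under perfect surjections, and satisfies Mrówka's condition (W): if a space $Z$ has a point $p$ with an open base $\mathscr{B}$ at $p$ such that $Z\setminus B$ has $\mathfrak{P}$ for all $B\in\mathscr{B}$, then $Z$ has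 $\mathfrak{P}$. *)

theory Defs
  imports "HOL-Analysis.Analysis"
begin

definition tychonoff :: "'a topology \<Rightarrow> bool" where
  "tychonoff X \<longleftrightarrow> completely_regular_space X \<and> Hausdorff_space X"

text \<open>A topological property is modelled by a predicate P on (Tychonoff) spaces
  carried by a fixed, sufficiently large universe type 'u.  A space Z of any
  other type has P iff some homeomorphic copy of Z in the universe has P.\<close>
definition hasP :: "('u topology \<Rightarrow> bool) \<Rightarrow> 'z topology \<Rightarrow> bool" where
  "hasP P Z \<longleftrightarrow> (\<exists>W::'u topology. Z homeomorphic_space W \<and> P W)"

definition compactness_like :: "('u topology \<Rightarrow> bool) \<Rightarrow> bool" where
  "compactness_like P \<longleftrightarrow>
     \<comment> \<open>hereditary to clopen subspaces\<close>
     (\<forall>Z A. tychonoff Z \<and> P Z \<and> closedin Z A \<and> openin Z A \<longrightarrow> P (subtopology Z A)) \<and>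
     \<comment> \<open>finitely additive\<close>
     (\<forall>Z \<A>. tychonoff Z \<and> finite \<A> \<and> pairwise disjnt \<A> \<and> \<Union>\<A> = topspace Z \<and>
            (\<forall>A\<in>\<A>. closedin Z A \<and> P (subtopology Z A)) \<longrightarrow> P Z) \<and>
     \<comment> \<open>invariant and inverse invariant under perfect surjections\<close>
     (\<forall>Z W f. tychonoff Z \<and> tychonoff W \<and> perfect_map Z W f \<longrightarrow> (P Z \<longleftrightarrow> P W)) \<and>
     \<comment> \<open>Mrowka's condition (W)\<close>
     (\<forall>Z p \<B>. tychonoff Z \<and> p \<in> topspace Z \<and>
            (\<forall>B\<in>\<B>. openin Z B \<and> p \<in> B) \<and>
            (\<forall>U. openin Z U \<and> p \<in> U \<longrightarrow> (\<exists>B\<in>\<B>. B \<subseteq> U)) \<and>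
            (\<forall>B\<in>\<B>. P (subtopology Z (topspace Z - B))) \<longrightarrow> P Z)"

definition locally_P :: "('u topology \<Rightarrow> bool) \<Rightarrow> 'a topology \<Rightarrow> bool" where
  "locally_P P X \<longleftrightarrow> (\<forall>x\<in>topspace X. \<exists>U. openin X U \<and> x \<in> U \<and>
       hasP P (subtopology X (X closure_of U)))"

definition cozero_sets :: "'a topology \<Rightarrow> 'a set set" where
  "cozero_sets X = {{x \<in> topspace X. f x \<noteq> 0} | f. continuous_map X euclideanreal f}"

definition stone_cech :: "'a topology \<Rightarrow> 'c topology \<Rightarrow> ('a \<Rightarrow> 'c) \<Rightarrow> bool" where
  "stone_cech X K e \<longleftrightarrow> compact_space K \<and> Hausdorff_space K \<and> embedding_map X K e \<and>
     K closure_of (e ` topspace X) = topspace K \<and>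
     (\<forall>f. continuous_map X euclideanreal f \<and> bounded (f ` topspace X) \<longrightarrow>
          (\<exists>g. continuous_map K euclideanreal g \<and> (\<forall>x\<in>topspace X. g (e x) = f x)))"

text \<open>lambda_P X, computed inside a Stone-Cech compactification (K, e) of X.\<close>
definition lambdaP :: "('u topology \<Rightarrow> bool) \<Rightarrow> 'a topology \<Rightarrow> 'c topology \<Rightarrow> ('a \<Rightarrow> 'c) \<Rightarrow> 'c set" where
  "lambdaP P X K e = \<Union>{K interior_of (K closure_of (e ` C)) | C.
       C \<in> cozero_sets X \<and> hasP P (subtopology X (X closure_of C))}"

text \<open>Extensions of X.  Every (Tychonoff) extension of X has at most 2^2^|X| points,
  so up to homeomorphism fixing X it can be realised on the type 'a + 'a set set,
  with X sitting inside via Inl and the remainder consisting of Inr-points.\<close>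
definition is_extension :: "'a topology \<Rightarrow> ('a + 'a set set) topology \<Rightarrow> bool" where
  "is_extension X T \<longleftrightarrow> tychonoff T \<and> topspace T \<inter> range Inl = Inl ` topspace X \<and>
     embedding_map X T Inl \<and> T closure_of (Inl ` topspace X) = topspace T"

definition ext_P :: "('u topology \<Rightarrow> bool) \<Rightarrow> 'a topology \<Rightarrow> ('a + 'a set set) topology set" where
  "ext_P P X = {T. is_extension X T \<and> hasP P T \<and> compactin T (topspace T - Inl ` topspace X)}"

definition ext_le :: "'a topology \<Rightarrow> ('a + 'a set set) topology \<Rightarrow> ('a + 'a set set) topology \<Rightarrow> bool" where
  "ext_le X T T' \<longleftrightarrow> (\<exists>g. continuous_map T' T g \<and> (\<forall>x\<in>topspace X. g (Inl x) = Inl x))"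

definition ext_equiv :: "'a topology \<Rightarrow> ('a + 'a set set) topology \<Rightarrow> ('a + 'a set set) topology \<Rightarrow> bool" where
  "ext_equiv X T T' \<longleftrightarrow> (\<exists>h. homeomorphic_map T T' h \<and> (\<forall>x\<in>topspace X. h (Inl x) = Inl x))"

definition E_P :: "('u topology \<Rightarrow> bool) \<Rightarrow> 'a topology \<Rightarrow> ('a + 'a set set) topology set set" where
  "E_P P X = (\<lambda>T. {T' \<in> ext_P P X. ext_equiv X T T'}) ` ext_P P X"

definition E_le :: "'a topology \<Rightarrow> ('a + 'a set set) topology set \<Rightarrow> ('a + 'a set set) topology set \<Rightarrow> bool" where
  "E_le X c c' \<longleftrightarrow> (\<exists>T\<in>c. \<exists>T'\<in>c'. ext_le X T T')"

definition order_isomorphic_E ::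
  "('u topology \<Rightarrow> bool) \<Rightarrow> 'a topology \<Rightarrow> 'b topology \<Rightarrow> bool" where
  "order_isomorphic_E P X Y \<longleftrightarrow> (\<exists>\<phi>. bij_betw \<phi> (E_P P X) (E_P P Y) \<and>
      (\<forall>c\<in>E_P P X. \<forall>c'\<in>E_P P X. E_le X c c' \<longleftrightarrow> E_le Y (\<phi> c) (\<phi> c')))"

end

theory Submission
  imports Defs
begin

text \<open>Let \<open>S = \<beta>X - X\<close>, which is compact since \<open>X\<close> is locally compact, and
  \<open>F = \<beta>X - \<lambda>\<^sub>PX\<close>. An extension \<open>T\<close> of \<open>X\<close> with compact remainder is a perfect image of
  \<open>X \<union> D\<close> for a unique compact \<open>D \<subseteq> S\<close>, under a map that is injective over \<open>X\<close>, and so it is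
  determined by the induced closed equivalence relation on \<open>D\<close>. Condition (W), applied to the
  one-point extension obtained by collapsing \<open>D\<close>, shows that \<open>T\<close> has \<open>P\<close> iff \<open>F \<subseteq> D\<close>. Hence the
  poset of extensions is dual to the inclusion order on the closed partial equivalence relations on
  \<open>S\<close> whose domain contains \<open>F\<close>. In the latter the atoms \<open>Id_on (insert x F)\<close> with \<open>x \<in> S - F\<close> are
  order-theoretically distinguishable from the atoms that identify two points of \<open>F\<close>, and the
  sets of such atoms below a given element are exactly the closed subsets of \<open>S - F\<close>, so that the
  order determines the space \<open>S - F = \<lambda>\<^sub>PX - X\<close>.\<close>

section \<open>Compactness-like properties across types\<close>

text \<open>The axioms speak of clopen subspaces and disjoint sums only. Heredity to closed
  subspaces and additivity over overlapping closed covers, on which the finite subcover argument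
  inside \<lambda> depends, are extracted from the perfect folding map of a disjoint sum onto the
  space. Since \<open>P\<close> is a predicate on one universe type, such a sum has to fit into the
  universe again. This is where the infinity of the universe enters; the double power set bound on
  the compactification keeps all spaces involved small. An extension involves two choices, the
  compact set D and the gluing on it. A partial equivalence relation records both, D being its
  domain, and so the order of extensions becomes plain reverse inclusion. Of the hypotheses on X,
  being locally \<open>P\<close> puts F inside S, and the failure of \<open>P\<close> makes F
  nonempty. A point of F serves twice: collapsing D then really adds a point, to which (W) applies,
  and a new point x has something to be glued to, which is how the two kinds of atoms are told
  apart.\<close>

lemma tychonoff_subtopology: "tychonoff Z \<Longrightarrow> tychonoff (subtopology Z A)"
  by (simp add: tychonoff_def completely_regular_space_subtopology Hausdorff_space_subtopology)

lemma homeomorphic_tychonoff: "Z homeomorphic_space W \<Longrightarrow> tychonoff Z \<longleftrightarrow> tychonoff W"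
  by (simp add: homeomorphic_Hausdorff_space homeomorphic_completely_regular_space tychonoff_def)

lemma tychonoff_prod_topology:
  "tychonoff Z \<Longrightarrow> tychonoff W \<Longrightarrow> tychonoff (prod_topology Z W)"
  by (simp add: tychonoff_def completely_regular_space_prod_topology Hausdorff_space_prod_topology)

lemma tychonoff_discrete_topology: "tychonoff (discrete_topology A)"
  by (simp add: tychonoff_def completely_regular_space_discrete_topology)

lemma perfect_map_restriction:
  assumes f: "perfect_map Z W f" and U: "{z \<in> topspace Z. f z \<in> V} = U"
  shows "perfect_map (subtopology Z U) (subtopology W V) f"
  unfolding perfect_map_def
proof (intro conjI)
  have c: "continuous_map Z W f" and s: "f ` topspace Z = topspace W" and p: "proper_map Z W f"
    using f by (auto simp: perfect_map_def)
  show "continuous_map (subtopology Z U) (subtopology W V) f"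
    using c U by (auto simp: continuous_map_in_subtopology continuous_map_from_subtopology)
  show "proper_map (subtopology Z U) (subtopology W V) f"
    using p U by (rule proper_map_restriction)
  show "f ` topspace (subtopology Z U) = topspace (subtopology W V)"
    using s U by auto
qed

lemma hasP_homeomorphic:
  fixes P :: "'u topology \<Rightarrow> bool"
  assumes "Z homeomorphic_space W"
  shows "hasP P Z \<longleftrightarrow> hasP P W"
proof -
  have "Z homeomorphic_space V \<longleftrightarrow> W homeomorphic_space V" for V :: "'u topology"
    using homeomorphic_space_trans[OF assms] homeomorphic_space_trans[OF assms[THEN homeomorphic_space_sym[THEN iffD1]]]
    by (rule iffI[rotated])
  then show ?thesis
    unfolding hasP_def by simp
qed

text \<open>The topology is carried over to the image of an injection by pulling it back along the
  inverse of the injection.\<close>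

lemma ex_homeomorphic_copy:
  fixes Z :: "'z topology"
  assumes "topspace Z \<lesssim> (UNIV :: 'u set)"
  obtains W :: "'u topology" where "Z homeomorphic_space W"
proof -
  obtain f :: "'z \<Rightarrow> 'u" where f: "inj_on f (topspace Z)"
    using assms by (auto simp: lepoll_def)
  let ?g = "inv_into (topspace Z) f"
  let ?W = "pullback_topology (f ` topspace Z) ?g Z"
  have gf: "\<And>z. z \<in> topspace Z \<Longrightarrow> ?g (f z) = z"
    using f by simp
  have "continuous_map Z ?W f"
  proof (rule continuous_map_pullback')
    show "continuous_map Z Z (?g \<circ> f)"
      by (rule continuous_map_eq[where f=id]) (use gf in auto)
  qed auto
  moreover have "continuous_map ?W Z (id \<circ> ?g)"
    by (intro continuous_map_pullback continuous_map_id)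
  ultimately have "homeomorphic_maps Z ?W f ?g"
    using gf by (auto simp: homeomorphic_maps_def topspace_pullback_topology)
  then show ?thesis
    using that homeomorphic_space_def by blast
qed

text \<open>The disjoint sum of two closed subspaces is realised inside the product with the discrete
  two-point space; this makes the folding map a restriction of a projection along a compact factor.\<close>

lemma perfect_map_fold_closed_pair:
  assumes A: "closedin Z A" "closedin Z B" "A \<union> B = topspace Z"
  defines "V \<equiv> subtopology (prod_topology (discrete_topology (UNIV :: bool set)) Z)
                 ({True} \<times> A \<union> {False} \<times> B)"
  shows "perfect_map V Z snd"
    and "closedin V ({True} \<times> A)" and "closedin V ({False} \<times> B)"
    and "topspace V = {True} \<times> A \<union> {False} \<times> B"
    and "subtopology V ({True} \<times> A) homeomorphic_space subtopology Z A"
    and "subtopology V ({False} \<times> B) homeomorphic_space subtopology Z B"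
proof -
  let ?D = "discrete_topology (UNIV :: bool set)"
  let ?S = "{True} \<times> A \<union> {False} \<times> B"
  have AZ: "A \<subseteq> topspace Z" "B \<subseteq> topspace Z"
    using A closedin_subset by blast+
  have cl: "closedin (prod_topology ?D Z) ({True} \<times> A)" "closedin (prod_topology ?D Z) ({False} \<times> B)"
    using A by (auto simp: closedin_prod_Times_iff)
  then have S: "closedin (prod_topology ?D Z) ?S"
    by blast
  have "compact_space ?D"
    by (simp add: compact_space_discrete_topology)
  then have "proper_map (prod_topology ?D Z) Z snd"
    unfolding proper_map_def
  proof (intro conjI ballI)
    fix y assume "y \<in> topspace Z"
    then have "{x \<in> topspace (prod_topology ?D Z). snd x = y} = UNIV \<times> {y}"
      by auto
    moreover have "compactin (prod_topology ?D Z) (UNIV \<times> {y})"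
      using \<open>y \<in> topspace Z\<close> \<open>compact_space ?D\<close>
      by (simp add: compactin_Times compact_space_def)
    ultimately show "compactin (prod_topology ?D Z) {x \<in> topspace (prod_topology ?D Z). snd x = y}"
      by simp
  qed (rule Abstract_Topological_Spaces.closed_map_snd)
  moreover have "proper_map V (prod_topology ?D Z) id"
    using S closed_map_id unfolding V_def
    by (intro closed_injective_imp_proper_map closed_map_from_subtopology) auto
  ultimately have "proper_map V Z (snd \<circ> id)"
    by (rule proper_map_compose[rotated])
  moreover show top: "topspace V = ?S"
    unfolding V_def using AZ by (auto simp: topspace_subtopology)
  moreover have "snd ` ?S = topspace Z"
    using A(3) by (simp add: image_Un)
  ultimately show "perfect_map V Z snd"
    unfolding perfect_map_def V_def
    by (simp add: continuous_map_from_subtopology continuous_map_snd)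
  show closed: "closedin V ({True} \<times> A)" "closedin V ({False} \<times> B)"
    unfolding V_def using cl by (simp_all add: closedin_subset_topspace)
  have emb: "homeomorphic_map (subtopology Z C) (subtopology V ({i} \<times> C)) (Pair i)"
    if "C \<subseteq> topspace Z" "{i} \<times> C \<subseteq> ?S" for i C
  proof -
    have "homeomorphic_maps (subtopology Z C) (subtopology V ({i} \<times> C)) (Pair i) snd"
      unfolding homeomorphic_maps_def
    proof (intro conjI)
      show "continuous_map (subtopology Z C) (subtopology V ({i} \<times> C)) (Pair i)"
        using that unfolding V_def subtopology_subtopology
        by (intro continuous_map_into_subtopology continuous_map_pairedI) auto
      show "continuous_map (subtopology V ({i} \<times> C)) (subtopology Z C) snd"
        unfolding V_def
        by (intro continuous_map_into_subtopology continuous_map_from_subtopology continuous_map_snd) auto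
    qed auto
    then show ?thesis
      using homeomorphic_maps_map by blast
  qed
  show "subtopology V ({True} \<times> A) homeomorphic_space subtopology Z A"
    "subtopology V ({False} \<times> B) homeomorphic_space subtopology Z B"
    using emb[OF AZ(1) Un_upper1] emb[OF AZ(2) Un_upper2]
    by (simp_all add: homeomorphic_map_imp_homeomorphic_space[THEN homeomorphic_space_sym[THEN iffD1]])
qed

section \<open>Closure properties of \<open>P\<close> on all small spaces\<close>

text \<open>The infinite universe has room for two disjoint copies of any set that it can hold, so
  that disjoint sums of small spaces stay small.\<close>

locale compactness_like_property =
  fixes P :: "'u topology \<Rightarrow> bool"
  assumes compactness_like: "compactness_like P"
    and infinite_universe: "infinite (UNIV :: 'u set)"
begin

lemma P_perfect:
  "tychonoff Z \<Longrightarrow> tychonoff W \<Longrightarrow> perfect_map Z W f \<Longrightarrow> P Z \<longleftrightarrow> P W"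
  using compactness_like unfolding compactness_like_def by blast

lemma P_additive:
  assumes "tychonoff Z" "finite \<A>" "pairwise disjnt \<A>" "\<Union>\<A> = topspace Z"
    and "\<And>A. A \<in> \<A> \<Longrightarrow> closedin Z A \<and> P (subtopology Z A)"
  shows "P Z"
proof -
  have "\<forall>Z \<A>. tychonoff Z \<and> finite \<A> \<and> pairwise disjnt \<A> \<and> \<Union>\<A> = topspace Z \<and>
      (\<forall>A\<in>\<A>. closedin Z A \<and> P (subtopology Z A)) \<longrightarrow> P Z"
    using compactness_like unfolding compactness_like_def by (elim conjE)
  then show ?thesis
    using assms by blast
qed

text \<open>Condition (W) specialised to the base of all open neighbourhoods of
  \<open>p\<close>.\<close>

lemma P_Mrowka:
  assumes "tychonoff Z" "p \<in> topspace Z"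
    and "\<And>B. openin Z B \<Longrightarrow> p \<in> B \<Longrightarrow> P (subtopology Z (topspace Z - B))"
  shows "P Z"
proof -
  have "\<forall>Z p \<B>. tychonoff Z \<and> p \<in> topspace Z \<and>
            (\<forall>B\<in>\<B>. openin Z B \<and> p \<in> B) \<and>
            (\<forall>U. openin Z U \<and> p \<in> U \<longrightarrow> (\<exists>B\<in>\<B>. B \<subseteq> U)) \<and>
            (\<forall>B\<in>\<B>. P (subtopology Z (topspace Z - B))) \<longrightarrow> P Z"
    using compactness_like unfolding compactness_like_def by (elim conjE)
  from this[rule_format, of Z p "{B. openin Z B \<and> p \<in> B}"] show ?thesis
    using assms by blast
qed

lemma P_clopen:
  assumes "tychonoff Z" "P Z" "closedin Z A" "openin Z A"
  shows "P (subtopology Z A)"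
proof -
  have "\<forall>Z A. tychonoff Z \<and> P Z \<and> closedin Z A \<and> openin Z A \<longrightarrow> P (subtopology Z A)"
    using compactness_like unfolding compactness_like_def by (elim conjE)
  then show ?thesis
    using assms by blast
qed

lemma P_homeomorphic: "tychonoff Z \<Longrightarrow> Z homeomorphic_space W \<Longrightarrow> P Z \<longleftrightarrow> P W"
  using P_perfect homeomorphic_imp_perfect_map homeomorphic_tychonoff
  unfolding homeomorphic_space by blast

text \<open>Homeomorphisms are perfect, so \<open>P\<close> takes the same value on all copies, and
  the existential quantifier in \<open>hasP\<close> may be replaced by any one of them.\<close>

lemma hasP_copy:
  assumes "tychonoff Z" "Z homeomorphic_space W"
  shows "hasP P Z \<longleftrightarrow> P W"
proof -
  have "tychonoff W"
    using assms(1) homeomorphic_tychonoff[OF assms(2)] by blast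
  moreover have "W homeomorphic_space V" if "Z homeomorphic_space V" for V :: "'u topology"
    using homeomorphic_space_trans[OF assms(2)[THEN homeomorphic_space_sym[THEN iffD1]] that] .
  ultimately show ?thesis
    using assms P_homeomorphic unfolding hasP_def by blast
qed

text \<open>The image of a small space is small, so both spaces have copies in the universe, and the
  map between them is conjugated by homeomorphisms.\<close>

lemma hasP_perfect:
  assumes Z: "tychonoff Z" and W: "tychonoff W" and f: "perfect_map Z W f"
    and small: "topspace Z \<lesssim> (UNIV :: 'u set)"
  shows "hasP P Z \<longleftrightarrow> hasP P W"
proof -
  have "topspace W \<lesssim> (UNIV :: 'u set)"
    using f lepoll_trans[OF image_lepoll[of f "topspace Z"] small] unfolding perfect_map_def by simp
  then obtain W' :: "'u topology" where W': "W homeomorphic_space W'"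
    by (rule ex_homeomorphic_copy)
  obtain Z' :: "'u topology" where Z': "Z homeomorphic_space Z'"
    using small by (rule ex_homeomorphic_copy)
  obtain h k where h: "homeomorphic_map Z' Z h" and k: "homeomorphic_map W W' k"
    using Z'[THEN homeomorphic_space_sym[THEN iffD1]] W' unfolding homeomorphic_space by blast
  have "perfect_map Z' W' (k \<circ> f \<circ> h)"
    using perfect_map_compose[OF perfect_map_compose[OF homeomorphic_imp_perfect_map[OF h] f]
        homeomorphic_imp_perfect_map[OF k]] by (simp add: o_assoc)
  moreover have "tychonoff Z'" "tychonoff W'"
    using Z W homeomorphic_tychonoff[OF Z'] homeomorphic_tychonoff[OF W'] by blast+
  ultimately have "P Z' \<longleftrightarrow> P W'"
    using P_perfect by blast
  then show ?thesis
    using hasP_copy[OF Z Z'] hasP_copy[OF W W'] by simp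
qed

lemma hasP_clopen:
  assumes Z: "tychonoff Z" "hasP P Z" and A: "closedin Z A" "openin Z A"
  shows "hasP P (subtopology Z A)"
proof -
  obtain W where W: "Z homeomorphic_space W" and "P W"
    using Z by (auto simp: hasP_def)
  then obtain h where h: "homeomorphic_map Z W h"
    unfolding homeomorphic_space by blast
  have AZ: "A \<subseteq> topspace Z"
    using A openin_subset by blast
  have "closedin W (h ` A)" "openin W (h ` A)"
    using A homeomorphic_map_closedness[OF h AZ] homeomorphic_map_openness[OF h AZ] by simp_all
  moreover have "tychonoff W"
    using Z homeomorphic_tychonoff[OF W] by blast
  ultimately have "P (subtopology W (h ` A))"
    using \<open>P W\<close> P_clopen by blast
  moreover have "homeomorphic_map (subtopology Z A) (subtopology W (h ` A)) h"
    using h AZ by (intro homeomorphic_map_subtopologies) (auto dest: homeomorphic_imp_surjective_map)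
  ultimately show ?thesis
    using homeomorphic_map_imp_homeomorphic_space unfolding hasP_def by blast
qed

lemma hasP_clopen_pair:
  assumes Z: "tychonoff Z" and small: "topspace Z \<lesssim> (UNIV :: 'u set)"
    and A: "closedin Z A" "closedin Z B" "A \<inter> B = {}" "A \<union> B = topspace Z"
    and P: "hasP P (subtopology Z A)" "hasP P (subtopology Z B)"
  shows "hasP P Z"
proof -
  obtain W :: "'u topology" where W: "Z homeomorphic_space W"
    using small by (rule ex_homeomorphic_copy)
  then obtain h where h: "homeomorphic_map Z W h"
    unfolding homeomorphic_space by blast
  have hZ: "h ` topspace Z = topspace W" and inj: "inj_on h (topspace Z)"
    using h homeomorphic_imp_surjective_map homeomorphic_imp_injective_map by blast+
  have W_tych: "tychonoff W"
    using Z homeomorphic_tychonoff[OF W] by blast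
  have P_img: "P (subtopology W (h ` C))" if C: "hasP P (subtopology Z C)" "closedin Z C" for C
  proof -
    have "homeomorphic_map (subtopology Z C) (subtopology W (h ` C)) h"
      using h C closedin_subset[OF C(2)] hZ by (intro homeomorphic_map_subtopologies) auto
    then show ?thesis
      using C hasP_copy[OF tychonoff_subtopology[OF Z] homeomorphic_map_imp_homeomorphic_space] by blast
  qed
  have closed: "closedin W (h ` A)" "closedin W (h ` B)"
    using A homeomorphic_map_closedness[OF h closedin_subset] by simp_all
  have "pairwise disjnt {h ` A, h ` B}"
    using inj A unfolding pairwise_def disjnt_def by (fastforce simp: inj_on_def)
  moreover have "\<Union>{h ` A, h ` B} = topspace W"
    using A hZ by (simp flip: image_Un)
  ultimately have "P W"
    using W_tych closed P_img A P by (intro P_additive[of W "{h ` A, h ` B}"]) auto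
  then show ?thesis
    using hasP_def W by blast
qed

text \<open>An infinite set is equipollent to its square, which contains two copies of every smaller
  set.\<close>

lemma bool_Times_lepoll_universe:
  assumes "A \<lesssim> (UNIV :: 'u set)"
  shows "(UNIV :: bool set) \<times> A \<lesssim> (UNIV :: 'u set)"
proof -
  have "(UNIV :: bool set) \<times> A \<lesssim> (UNIV :: 'u set) \<times> (UNIV :: 'u set)"
    by (rule times_lepoll_mono[OF finite_lepoll_infinite[OF infinite_universe] assms]) simp
  moreover have "\<exists>f. bij_betw f ((UNIV :: 'u set) \<times> (UNIV :: 'u set)) (UNIV :: 'u set)"
    using infinite_universe card_of_Times_same_infinite card_of_ordIso by blast
  then have "(UNIV :: 'u set) \<times> (UNIV :: 'u set) \<lesssim> (UNIV :: 'u set)"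
    using eqpoll_def eqpoll_imp_lepoll by blast
  ultimately show ?thesis
    using lepoll_trans by blast
qed

lemma small_sum:
  assumes "topspace Z \<lesssim> (UNIV :: 'u set)" "A \<subseteq> topspace Z" "B \<subseteq> topspace Z"
  shows "{True} \<times> A \<union> {False} \<times> B \<lesssim> (UNIV :: 'u set)"
proof -
  have "{True} \<times> A \<union> {False} \<times> B \<subseteq> (UNIV :: bool set) \<times> topspace Z"
    using assms(2,3) by blast
  then have "{True} \<times> A \<union> {False} \<times> B \<lesssim> (UNIV :: bool set) \<times> topspace Z"
    by (rule subset_imp_lepoll)
  then show ?thesis
    using bool_Times_lepoll_universe[OF assms(1)] lepoll_trans by blast
qed

text \<open>The disjoint sum of \<open>A\<close> and \<open>B\<close> has \<open>P\<close> by
  disjoint additivity, and the folding map carries \<open>P\<close> down to \<open>Z\<close>. The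
  overlap of \<open>A\<close> and \<open>B\<close> does no harm because perfect maps need not be
  injective.\<close>

lemma hasP_closed_Un:
  assumes Z: "tychonoff Z" and small: "topspace Z \<lesssim> (UNIV :: 'u set)"
    and A: "closedin Z A" "closedin Z B" "A \<union> B = topspace Z"
    and P: "hasP P (subtopology Z A)" "hasP P (subtopology Z B)"
  shows "hasP P Z"
proof -
  let ?V = "subtopology (prod_topology (discrete_topology (UNIV :: bool set)) Z)
                 ({True} \<times> A \<union> {False} \<times> B)"
  note V = perfect_map_fold_closed_pair[OF A]
  have tych: "tychonoff ?V"
    using Z by (intro tychonoff_subtopology tychonoff_prod_topology tychonoff_discrete_topology)
  have small': "topspace ?V \<lesssim> (UNIV :: 'u set)"
    using V(4) small_sum[OF small closedin_subset closedin_subset, OF A(1,2)] by simp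
  have "hasP P ?V"
    using tych small' V(2,3)
  proof (rule hasP_clopen_pair)
    show "({True} \<times> A) \<inter> ({False} \<times> B) = {}"
      by blast
    show "{True} \<times> A \<union> {False} \<times> B = topspace ?V"
      using V(4) by simp
    show "hasP P (subtopology ?V ({True} \<times> A))" "hasP P (subtopology ?V ({False} \<times> B))"
      unfolding hasP_homeomorphic[OF V(5)] hasP_homeomorphic[OF V(6)] by (fact P)+
  qed
  then show ?thesis
    using hasP_perfect[OF tych Z V(1) small'] by simp
qed

text \<open>The disjoint sum of \<open>A\<close> and the whole of \<open>Z\<close> folds perfectly
  onto \<open>Z\<close> and so inherits \<open>P\<close> by inverse invariance. In the sum, the copy
  of \<open>A\<close> is clopen.\<close>

lemma hasP_closed:
  assumes Z: "tychonoff Z" and small: "topspace Z \<lesssim> (UNIV :: 'u set)"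
    and P: "hasP P Z" and A: "closedin Z A"
  shows "hasP P (subtopology Z A)"
proof -
  let ?V = "subtopology (prod_topology (discrete_topology (UNIV :: bool set)) Z)
                 ({True} \<times> A \<union> {False} \<times> topspace Z)"
  have AZ: "A \<subseteq> topspace Z"
    using A closedin_subset by blast
  then have "A \<union> topspace Z = topspace Z"
    by blast
  note V = perfect_map_fold_closed_pair[OF A closedin_topspace this]
  have tych: "tychonoff ?V"
    using Z by (intro tychonoff_subtopology tychonoff_prod_topology tychonoff_discrete_topology)
  have small': "topspace ?V \<lesssim> (UNIV :: 'u set)"
    using V(4) small_sum[OF small AZ] by simp
  have "hasP P ?V"
    using hasP_perfect[OF tych Z V(1) small'] P by simp
  moreover have "openin ?V ({True} \<times> A)"
  proof -
    have "{True} \<times> A = topspace ?V - {False} \<times> topspace Z"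
      using V(4) by blast
    then show ?thesis
      using openin_diff[OF openin_topspace V(3)] by simp
  qed
  ultimately show ?thesis
    using hasP_clopen[OF tych _ V(2)] unfolding hasP_homeomorphic[OF V(5)] by simp
qed

text \<open>This is finite additivity for the empty family.\<close>

lemma hasP_empty:
  assumes "topspace Z = {}"
  shows "hasP P Z"
proof -
  let ?W = "trivial_topology :: 'u topology"
  have "tychonoff ?W"
    using tychonoff_discrete_topology by metis
  then have "P ?W"
    by (rule P_additive[where \<A> = "{}"]) auto
  moreover have "Z homeomorphic_space ?W"
    using assms by (simp add: homeomorphic_empty_space_eq)
  ultimately show ?thesis
    using hasP_def by blast
qed

lemma hasP_closed_Union:
  assumes Z: "tychonoff Z" and small: "topspace Z \<lesssim> (UNIV :: 'u set)"
    and "finite \<A>" "\<And>A. A \<in> \<A> \<Longrightarrow> closedin Z A \<and> hasP P (subtopology Z A)"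
  shows "hasP P (subtopology Z (\<Union>\<A>))"
  using assms(3,4)
proof (induction \<A> rule: finite_induct)
  case empty
  then show ?case
    by (simp add: hasP_empty)
next
  case (insert A \<A>)
  let ?Z = "subtopology Z (A \<union> \<Union>\<A>)"
  have cl: "closedin Z A" "closedin Z (\<Union>\<A>)"
    using insert.hyps(1) insert.prems by (auto intro!: closedin_Union)
  have eq: "subtopology ?Z A = subtopology Z A" "subtopology ?Z (\<Union>\<A>) = subtopology Z (\<Union>\<A>)"
    by (simp_all add: subtopology_subtopology inf.absorb2)
  have "hasP P ?Z"
  proof (rule hasP_closed_Un)
    show "tychonoff ?Z"
      using Z by (rule tychonoff_subtopology)
    show "topspace ?Z \<lesssim> (UNIV :: 'u set)"
      using small subset_imp_lepoll[of "topspace ?Z" "topspace Z"] lepoll_trans by auto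
    show "closedin ?Z A" "closedin ?Z (\<Union>\<A>)"
      using cl by (auto simp: closedin_subset_topspace)
    show "A \<union> \<Union>\<A> = topspace ?Z"
      using cl closedin_subset by fastforce
    show "hasP P (subtopology ?Z A)" "hasP P (subtopology ?Z (\<Union>\<A>))"
      using insert eq by auto
  qed
  then show ?case
    by simp
qed

lemma hasP_Mrowka:
  assumes Z: "tychonoff Z" and small: "topspace Z \<lesssim> (UNIV :: 'u set)" and p: "p \<in> topspace Z"
    and P: "\<And>B. openin Z B \<Longrightarrow> p \<in> B \<Longrightarrow> hasP P (subtopology Z (topspace Z - B))"
  shows "hasP P Z"
proof -
  obtain W :: "'u topology" where W: "Z homeomorphic_space W"
    using small by (rule ex_homeomorphic_copy)
  then obtain k h where "homeomorphic_maps Z W k h"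
    unfolding homeomorphic_space_def by blast
  then have hk: "homeomorphic_maps W Z h k"
    by (rule homeomorphic_maps_sym[THEN iffD1])
  then have h: "homeomorphic_map W Z h" and k: "homeomorphic_map Z W k"
    using homeomorphic_maps_map by blast+
  have kp: "k p \<in> topspace W" "h (k p) = p"
    using hk p by (auto simp: homeomorphic_maps_def continuous_map_def)
  have W_tych: "tychonoff W"
    using Z homeomorphic_tychonoff[OF W] by blast
  have "P (subtopology W (topspace W - B))" if B: "openin W B" "k p \<in> B" for B
  proof -
    have BW: "B \<subseteq> topspace W"
      using B openin_subset by blast
    have hB: "openin Z (h ` B)" "p \<in> h ` B"
      using B homeomorphic_map_openness[OF h BW] kp image_eqI[of p h "k p" B] by simp_all
    have "h ` (topspace W \<inter> (topspace W - B)) = topspace Z \<inter> (topspace Z - h ` B)"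
    proof -
      have "h ` topspace W = topspace Z" "inj_on h (topspace W)"
        using h homeomorphic_imp_surjective_map homeomorphic_imp_injective_map by blast+
      then show ?thesis
        using BW inj_on_image_set_diff[of h "topspace W" "topspace W" B]
        by (simp add: Int_absorb1)
    qed
    then have "homeomorphic_map (subtopology W (topspace W - B)) (subtopology Z (topspace Z - h ` B)) h"
      using h homeomorphic_map_subtopologies by blast
    then have "subtopology W (topspace W - B) homeomorphic_space subtopology Z (topspace Z - h ` B)"
      unfolding homeomorphic_space by blast
    then show ?thesis
      using hasP_copy[OF tychonoff_subtopology[OF Z] homeomorphic_space_sym[THEN iffD1]] P[OF hB]
      by blast
  qed
  then have "P W"
    using P_Mrowka kp W_tych by blast
  then show ?thesis
    using hasP_def W by blast
qed

end

section \<open>Extensions as perfect images of subspaces of the Stone-Cech compactification\<close>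

lemma embedding_map_imp_continuous_map: "embedding_map Z W f \<Longrightarrow> continuous_map Z W f"
  unfolding embedding_map_def
  by (blast dest: homeomorphic_imp_continuous_map intro: continuous_map_into_fulltopology)

locale stone_cech_space =
  fixes X :: "'a topology" and K :: "'c topology" and e :: "'a \<Rightarrow> 'c"
  assumes stone_cech: "stone_cech X K e"
begin

lemma compact_K: "compact_space K" and Hausdorff_K: "Hausdorff_space K"
  and embedding_e: "embedding_map X K e"
  and dense_e: "K closure_of (e ` topspace X) = topspace K"
  using stone_cech by (auto simp: stone_cech_def)

lemma continuous_e: "continuous_map X K e"
  using embedding_e embedding_map_imp_continuous_map by blast

lemma e_in: "x \<in> topspace X \<Longrightarrow> e x \<in> topspace K"
  using continuous_e by (auto simp: continuous_map_def)

lemma inj_e: "inj_on e (topspace X)"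
  using embedding_e unfolding embedding_map_def by (blast dest: homeomorphic_imp_injective_map)

lemma meets_dense:
  assumes "openin K G" "u \<in> G"
  obtains x where "x \<in> topspace X" "e x \<in> G"
proof -
  have "u \<in> K closure_of (e ` topspace X)"
    using assms openin_subset dense_e by blast
  then show ?thesis
    using assms that by (auto simp: in_closure_of)
qed

lemma extends_to_unit_interval:
  assumes "continuous_map X (top_of_set {0..1::real}) f"
  obtains g where "continuous_map K (top_of_set {0..1}) g" "\<And>x. x \<in> topspace X \<Longrightarrow> g (e x) = f x"
proof -
  have f: "continuous_map X euclideanreal f" "f ` topspace X \<subseteq> {0..1}"
    using assms by (auto simp: continuous_map_in_subtopology)
  moreover have "bounded (f ` topspace X)"
    using f(2) bounded_closed_interval bounded_subset by blast
  ultimately obtain g where g: "continuous_map K euclideanreal g" "\<forall>x\<in>topspace X. g (e x) = f x"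
    using stone_cech unfolding stone_cech_def by blast
  show ?thesis
  proof
    \<comment> \<open>The extension is only known to be real-valued; truncating it to the unit
      interval changes nothing on \<open>X\<close>, where the values already lie there.\<close>
    show "continuous_map K (top_of_set {0..1}) (\<lambda>u. max 0 (min (g u) 1))"
      using g by (auto simp: continuous_map_in_subtopology intro!: continuous_map_real_max continuous_map_real_min)
    show "max 0 (min (g (e x)) 1) = f x" if "x \<in> topspace X" for x
      using f(2) g(2) that by (force simp: image_subset_iff)
  qed
qed

lemma extends_to_cube:
  fixes I :: "'i set"
  assumes f: "continuous_map X (product_topology (\<lambda>_. top_of_set {0..1::real}) I) f"
  obtains g where "continuous_map K (product_topology (\<lambda>_. top_of_set {0..1::real}) I) g"
    "\<And>x. x \<in> topspace X \<Longrightarrow> g (e x) = f x"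
proof -
  have fk: "f ` topspace X \<subseteq> extensional I"
    "\<And>k. k \<in> I \<Longrightarrow> continuous_map X (top_of_set {0..1::real}) (\<lambda>x. f x k)"
    using f by (auto simp: continuous_map_componentwise)
  have "\<exists>g. continuous_map K (top_of_set {0..1}) g \<and> (\<forall>x\<in>topspace X. g (e x) = f x k)"
    if "k \<in> I" for k
    using extends_to_unit_interval[OF fk(2)[OF that]] by metis
  then obtain G where G: "\<And>k. k \<in> I \<Longrightarrow> continuous_map K (top_of_set {0..1}) (G k)"
    "\<And>k x. k \<in> I \<Longrightarrow> x \<in> topspace X \<Longrightarrow> G k (e x) = f x k"
    by metis
  show ?thesis
  proof
    show "continuous_map K (product_topology (\<lambda>_. top_of_set {0..1::real}) I) (\<lambda>u. \<lambda>k\<in>I. G k u)"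
      using G(1) by (auto simp: continuous_map_componentwise)
    show "(\<lambda>k\<in>I. G k (e x)) = f x" if "x \<in> topspace X" for x
      using fk(1) G(2) that by (auto simp: extensional_def fun_eq_iff image_subset_iff)
  qed
qed

section \<open>Presentations of extensions and their kernels\<close>

text \<open>The pair \<open>Z\<close>, \<phi> is what remains of the Stone-Cech extension of
  \<open>i\<close> over the points that are sent into \<open>T\<close>, when \<open>T\<close> is
  seen inside a compact space. The map \<open>i\<close> is kept general; extensions use
  \<open>Inl\<close>.\<close>

definition presents :: "('a \<Rightarrow> 't) \<Rightarrow> 't topology \<Rightarrow> 'c set \<Rightarrow> ('c \<Rightarrow> 't) \<Rightarrow> bool" where
  "presents i T Z \<phi> \<longleftrightarrow> e ` topspace X \<subseteq> Z \<and> Z \<subseteq> topspace K \<and>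
     perfect_map (subtopology K Z) T \<phi> \<and> (\<forall>x\<in>topspace X. \<phi> (e x) = i x)"

text \<open>\<open>T\<close> is embedded in a cube and \<open>X\<close> is mapped there through
  \<open>T\<close>; this map extends to all of \<open>K\<close>. The extension is proper by
  compactness, and properness survives restriction to a full preimage, here the preimage
  \<open>Z\<close> of \<open>T\<close>.\<close>

lemma ex_presents:
  fixes T :: "'t topology"
  assumes T: "tychonoff T" and i: "embedding_map X T i"
    and dense: "T closure_of (i ` topspace X) = topspace T"
  obtains Z \<phi> where "presents i T Z \<phi>"
proof -
  obtain I :: "('t \<Rightarrow> real) set" and \<eta>
    where \<eta>: "embedding_map T (product_topology (\<lambda>_. top_of_set {0..1::real}) I) \<eta>"
    using T completely_regular_space_cube_embedding unfolding tychonoff_def by blast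
  define C where "C = product_topology (\<lambda>_. top_of_set {0..1::real}) I"
  have C: "Hausdorff_space C"
    unfolding C_def by (simp add: Hausdorff_space_product_topology Hausdorff_space_subtopology)
  obtain \<theta> where \<theta>: "homeomorphic_maps T (subtopology C (\<eta> ` topspace T)) \<eta> \<theta>"
    using \<eta> unfolding C_def[symmetric] embedding_map_def homeomorphic_map_maps by blast
  have \<eta>_cont: "continuous_map T C \<eta>" 
    using \<eta> C_def embedding_map_imp_continuous_map by blast
  have i_cont: "continuous_map X T i"
    using i embedding_map_imp_continuous_map by blast
  obtain \<psi> where \<psi>: "continuous_map K C \<psi>" "\<And>x. x \<in> topspace X \<Longrightarrow> \<psi> (e x) = \<eta> (i x)"
    using extends_to_cube[of I "\<eta> \<circ> i"] continuous_map_compose[OF i_cont \<eta>_cont] unfolding C_def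
    by auto
  have proper: "proper_map K C \<psi>"
    using compact_K C \<psi>(1) by (simp add: continuous_imp_proper_map Hausdorff_imp_kc_space)
  then have "closedin C (\<psi> ` topspace K)"
    using proper_imp_closed_map closed_map_def closedin_topspace by blast
  moreover have "\<eta> ` i ` topspace X \<subseteq> \<psi> ` topspace K"
  proof clarify
    fix x assume "x \<in> topspace X"
    then show "\<eta> (i x) \<in> \<psi> ` topspace K"
      using \<psi>(2) e_in by (metis imageI)
  qed
  moreover have "\<eta> ` topspace T \<subseteq> C closure_of (\<eta> ` i ` topspace X)"
    using continuous_map_image_closure_subset[OF \<eta>_cont, of "i ` topspace X"] dense by simp
  \<comment> \<open>The image of the compact \<open>K\<close> is closed in the cube and contains the
    image of \<open>X\<close>, hence also that of \<open>T\<close>, in which \<open>X\<close> is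
    dense.\<close>
  ultimately have onto: "\<eta> ` topspace T \<subseteq> \<psi> ` topspace K"
    using closure_of_minimal[of "\<eta> ` i ` topspace X" "\<psi> ` topspace K" C] by blast
  define Z where "Z = {u \<in> topspace K. \<psi> u \<in> \<eta> ` topspace T}"
  have "perfect_map (subtopology K Z) (subtopology C (\<eta> ` topspace T)) \<psi>"
    unfolding perfect_map_def
  proof (intro conjI)
    show "continuous_map (subtopology K Z) (subtopology C (\<eta> ` topspace T)) \<psi>"
      using \<psi>(1) by (auto simp: Z_def continuous_map_in_subtopology continuous_map_from_subtopology)
    show "proper_map (subtopology K Z) (subtopology C (\<eta> ` topspace T)) \<psi>"
      using proper by (rule proper_map_restriction) (simp add: Z_def)
    have "\<eta> ` topspace T \<subseteq> topspace C"
      using \<eta>_cont continuous_map_image_subset_topspace by blast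
    moreover have "\<psi> ` Z = \<psi> ` topspace K \<inter> \<eta> ` topspace T" and "topspace K \<inter> Z = Z"
      by (auto simp: Z_def)
    ultimately show "\<psi> ` topspace (subtopology K Z) = topspace (subtopology C (\<eta> ` topspace T))"
      using onto by (simp add: Int_absorb1)
  qed
  moreover have "perfect_map (subtopology C (\<eta> ` topspace T)) T \<theta>"
    using \<theta> unfolding homeomorphic_maps_map by (simp add: homeomorphic_imp_perfect_map)
  ultimately have "perfect_map (subtopology K Z) T (\<theta> \<circ> \<psi>)"
    by (rule perfect_map_compose)
  moreover have "(\<theta> \<circ> \<psi>) (e x) = i x" "e x \<in> Z" if "x \<in> topspace X" for x
  proof -
    have "i x \<in> topspace T"
      using that i_cont by (auto simp: continuous_map_def)
    then show "(\<theta> \<circ> \<psi>) (e x) = i x" "e x \<in> Z"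
      using \<psi>(2)[OF that] \<theta> e_in[OF that] by (auto simp: homeomorphic_maps_def Z_def)
  qed
  ultimately have "presents i T Z (\<theta> \<circ> \<psi>)"
    unfolding presents_def Z_def by auto
  then show ?thesis
    using that by blast
qed

text \<open>A perfect map admits no continuous extension to a larger subspace containing the domain as
  a dense subset, since its fibres are compact, hence closed in \<open>K\<close>.\<close>

lemma presents_maximal:
  assumes pr: "presents i T Z \<phi>" and Z': "e ` topspace X \<subseteq> Z'" "Z' \<subseteq> topspace K"
    and h: "continuous_map (subtopology K Z') T h" and hi: "\<And>x. x \<in> topspace X \<Longrightarrow> h (e x) = i x"
    and u: "u \<in> Z'"
  shows "u \<in> Z \<and> \<phi> u = h u"
proof (rule ccontr)
  assume neg: "\<not> (u \<in> Z \<and> \<phi> u = h u)"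
  have ZK: "e ` topspace X \<subseteq> Z" "Z \<subseteq> topspace K" and \<phi>: "perfect_map (subtopology K Z) T \<phi>"
    and \<phi>i: "\<And>x. x \<in> topspace X \<Longrightarrow> \<phi> (e x) = i x"
    using pr by (auto simp: presents_def)
  have topZ: "topspace (subtopology K Z) = Z" "topspace (subtopology K Z') = Z'"
    using ZK Z' by auto
  have hu: "h u \<in> topspace T"
    using h u topZ(2) by (auto simp: continuous_map_def)
  \<comment> \<open>Whether \<open>u\<close> is outside \<open>Z\<close> or \<phi> and
    \<open>h\<close> disagree at it, \<open>u\<close> is not in this compact fibre and can be
    separated from it by open sets.\<close>
  let ?A = "{z \<in> Z. \<phi> z = h u}"
  have "compactin (subtopology K Z) ?A"
    using \<phi> hu unfolding perfect_map_def proper_map_def topZ(1) by blast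
  then have "compactin K ?A"
    by (simp add: compactin_subtopology)
  moreover have "compactin K {u}"
    using u Z' by auto
  moreover have "disjnt {u} ?A"
    using neg by simp
  ultimately obtain V W where VW: "openin K V" "openin K W" "{u} \<subseteq> V" "?A \<subseteq> W" "disjnt V W"
    using Hausdorff_K[unfolded Hausdorff_space_compact_sets, rule_format, of "{u}" ?A] by blast
  have "openin (subtopology K Z) (Z \<inter> W)" "{z \<in> topspace (subtopology K Z). \<phi> z = h u} \<subseteq> Z \<inter> W"
    using VW topZ(1) by (auto simp: openin_subtopology_Int2)
  moreover have "closed_map (subtopology K Z) T \<phi>"
    using \<phi> by (simp add: perfect_imp_closed_map)
  \<comment> \<open>Since \<phi> is closed, a whole neighbourhood of the value \<open>h u\<close>
    has its preimage inside \<open>W\<close>. Points of \<open>X\<close> near \<open>u\<close> are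
    then forced into both \<open>V\<close> and \<open>W\<close>.\<close>
  ultimately obtain O' where O: "openin T O'" "h u \<in> O'"
    "{z \<in> topspace (subtopology K Z). \<phi> z \<in> O'} \<subseteq> Z \<inter> W"
    using hu unfolding closed_map_fibre_neighbourhood by blast
  have "openin (subtopology K Z') {z \<in> topspace (subtopology K Z'). h z \<in> O'}"
    using h O(1) openin_continuous_map_preimage by blast
  then obtain G where G: "openin K G" "{z \<in> Z'. h z \<in> O'} = Z' \<inter> G"
    using topZ(2) by (auto simp: openin_subtopology Int_commute)
  have "openin K (G \<inter> V)" "u \<in> G \<inter> V"
    using G VW u O by auto
  then obtain x where x: "x \<in> topspace X" "e x \<in> G \<inter> V"
    using meets_dense by blast
  then have "h (e x) \<in> O'"
    using G(2) Z' by blast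
  then have "\<phi> (e x) \<in> O'"
    using hi \<phi>i x by simp
  then have "e x \<in> W"
    using O(3) ZK x unfolding topZ(1) by blast
  then show False
    using x VW(5) by (auto simp: disjnt_iff)
qed

text \<open>\<open>X\<close> carries the topology induced from \<open>T\<close>: if
  \<open>e y\<close> is close to \<open>u\<close>, then \<open>i y\<close> is close to
  \<open>i x\<close>, so \<open>y\<close> is close to \<open>x\<close> and \<open>e y\<close> is
  close to \<open>e x\<close>. Were \<open>u\<close> and \<open>e x\<close> distinct, disjoint
  neighbourhoods would contradict this. So no point of \<open>Z\<close> outside the image of
  \<open>X\<close> is mapped into \<open>X\<close>.\<close>

lemma presents_fibre:
  assumes pr: "presents i T Z \<phi>" and i: "embedding_map X T i"
    and u: "u \<in> Z" "\<phi> u = i x" and x: "x \<in> topspace X"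
  shows "u = e x"
proof (rule ccontr)
  assume neg: "u \<noteq> e x"
  have ZK: "e ` topspace X \<subseteq> Z" "Z \<subseteq> topspace K" and \<phi>: "continuous_map (subtopology K Z) T \<phi>"
    and \<phi>i: "\<And>x. x \<in> topspace X \<Longrightarrow> \<phi> (e x) = i x"
    using pr by (auto simp: presents_def perfect_map_def)
  have topZ: "topspace (subtopology K Z) = Z"
    using ZK by auto
  have "u \<in> topspace K" "e x \<in> topspace K"
    using u ZK x e_in by auto
  then obtain V W where VW: "openin K V" "openin K W" "u \<in> V" "e x \<in> W" "disjnt V W"
    using Hausdorff_K[unfolded Hausdorff_space_def, rule_format, of u "e x"] neg by blast
  let ?N = "{y \<in> topspace X. e y \<in> W}"
  have "openin X ?N"
    using continuous_e VW(2) openin_continuous_map_preimage by blast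
  moreover have hi: "homeomorphic_map X (subtopology T (i ` topspace X)) i"
    using i by (simp add: embedding_map_def)
  ultimately have "openin (subtopology T (i ` topspace X)) (i ` ?N)"
    using homeomorphic_imp_open_map open_map_def by blast
  then obtain O' where O: "openin T O'" "i ` ?N = O' \<inter> i ` topspace X"
    by (auto simp: openin_subtopology)
  have "openin (subtopology K Z) {z \<in> topspace (subtopology K Z). \<phi> z \<in> O'}"
    using \<phi> O(1) openin_continuous_map_preimage by blast
  then obtain G where G: "openin K G" "{z \<in> Z. \<phi> z \<in> O'} = Z \<inter> G"
    using topZ by (auto simp: openin_subtopology Int_commute)
  have "i x \<in> O'"
    using O(2) x VW(4) by blast
  then have "u \<in> {z \<in> Z. \<phi> z \<in> O'}"
    using u by simp
  then have "u \<in> G \<inter> V" "openin K (G \<inter> V)"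
    using G VW by auto
  then obtain y where y: "y \<in> topspace X" "e y \<in> G \<inter> V"
    using meets_dense by blast
  then have "\<phi> (e y) \<in> O'"
    using G(2) ZK by blast
  then have "i y \<in> i ` ?N"
    using O(2) \<phi>i y by auto
  then have "e y \<in> W"
    using homeomorphic_imp_injective_map[OF hi] y by (auto simp: inj_on_def)
  then show False
    using y VW(5) by (auto simp: disjnt_iff)
qed

text \<open>The diagonal part of this relation recovers \<open>Z\<close> outside \<open>X\<close>,
  so the relation remembers the subspace as well as the fibres of \<phi>.\<close>

definition remainder_kernel :: "'c set \<Rightarrow> ('c \<Rightarrow> 't) \<Rightarrow> 'c rel" where
  "remainder_kernel Z \<phi> = {(u, v). u \<in> Z - e ` topspace X \<and> v \<in> Z - e ` topspace X \<and> \<phi> u = \<phi> v}"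

text \<open>If \<open>g\<close> exists, then \<open>g\<close> after \<phi>' extends \<open>i\<close>
  continuously over \<open>Z'\<close>, and maximality of \<open>Z\<close> yields that
  \<open>Z'\<close> is contained in \<open>Z\<close> with \<phi> equal to this composite on
  \<open>Z'\<close>. Conversely, the diagonal of the kernels gives this containment, and \<phi> is
  constant on the fibres of \<phi>' (over \<open>X\<close> they are singletons), so it factors
  through the quotient map \<phi>'.\<close>

lemma presents_le_iff:
  assumes pr: "presents i T Z \<phi>" and pr': "presents i' T' Z' \<phi>'"
    and i': "embedding_map X T' i'"
  shows "(\<exists>g. continuous_map T' T g \<and> (\<forall>x\<in>topspace X. g (i' x) = i x)) \<longleftrightarrow>
    remainder_kernel Z' \<phi>' \<subseteq> remainder_kernel Z \<phi>"
proof
  have ZK': "e ` topspace X \<subseteq> Z'" "Z' \<subseteq> topspace K" and \<phi>': "perfect_map (subtopology K Z') T' \<phi>'"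
    and \<phi>i': "\<And>x. x \<in> topspace X \<Longrightarrow> \<phi>' (e x) = i' x"
    using pr' by (auto simp: presents_def)
  have ZK: "e ` topspace X \<subseteq> Z" "Z \<subseteq> topspace K" and \<phi>: "perfect_map (subtopology K Z) T \<phi>"
    and \<phi>i: "\<And>x. x \<in> topspace X \<Longrightarrow> \<phi> (e x) = i x"
    using pr by (auto simp: presents_def)
  {
    assume "\<exists>g. continuous_map T' T g \<and> (\<forall>x\<in>topspace X. g (i' x) = i x)"
    then obtain g where g: "continuous_map T' T g" "\<And>x. x \<in> topspace X \<Longrightarrow> g (i' x) = i x"
      by blast
    have "continuous_map (subtopology K Z') T (g \<circ> \<phi>')"
      using \<phi>' g(1) continuous_map_compose perfect_map_def by blast
    then have "u \<in> Z \<and> \<phi> u = (g \<circ> \<phi>') u" if "u \<in> Z'" for u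
      using presents_maximal[OF pr ZK' _ _ that] g(2) \<phi>i' by simp
    then show "remainder_kernel Z' \<phi>' \<subseteq> remainder_kernel Z \<phi>"
      unfolding remainder_kernel_def by auto
  }
  assume sub: "remainder_kernel Z' \<phi>' \<subseteq> remainder_kernel Z \<phi>"
  have "Z' \<subseteq> Z"
  proof
    fix u assume "u \<in> Z'"
    then have "u \<in> e ` topspace X \<or> (u, u) \<in> remainder_kernel Z' \<phi>'"
      by (auto simp: remainder_kernel_def)
    then show "u \<in> Z"
      using sub ZK by (auto simp: remainder_kernel_def)
  qed
  then have "subtopology K Z' = subtopology (subtopology K Z) Z'"
    by (simp add: subtopology_subtopology inf.absorb2)
  then have cont: "continuous_map (subtopology K Z') T \<phi>"
    using \<phi> continuous_map_from_subtopology perfect_imp_continuous_map by metis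
  have "\<phi> u = \<phi> v" if uv: "u \<in> topspace (subtopology K Z')" "v \<in> topspace (subtopology K Z')" "\<phi>' u = \<phi>' v" for u v
  proof (cases "u \<in> e ` topspace X \<or> v \<in> e ` topspace X")
    case True
    then have "u = v"
    proof
      assume "u \<in> e ` topspace X"
      then obtain x where x: "x \<in> topspace X" "u = e x"
        by blast
      then have "v = e x"
        using uv(2,3) \<phi>i'[OF x(1)] by (intro presents_fibre[OF pr' i' _ _ x(1)]) simp_all
      then show ?thesis
        using x by simp
    next
      assume "v \<in> e ` topspace X"
      then obtain x where x: "x \<in> topspace X" "v = e x"
        by blast
      then have "u = e x"
        using uv(1,3) \<phi>i'[OF x(1)] by (intro presents_fibre[OF pr' i' _ _ x(1)]) simp_all
      then show ?thesis
        using x by simp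
    qed
    then show ?thesis by simp
  next
    case False
    then have "(u, v) \<in> remainder_kernel Z' \<phi>'"
      using uv by (auto simp: remainder_kernel_def)
    then show ?thesis
      using sub by (auto simp: remainder_kernel_def)
  qed
  then obtain g where g: "continuous_map T' T g" "\<And>u. u \<in> topspace (subtopology K Z') \<Longrightarrow> g (\<phi>' u) = \<phi> u"
    using quotient_map_lift_exists[OF perfect_imp_quotient_map[OF \<phi>'] cont] by metis
  have "g (i' x) = i x" if "x \<in> topspace X" for x
    using g(2)[of "e x"] that ZK' e_in \<phi>i \<phi>i' by auto
  then show "\<exists>g. continuous_map T' T g \<and> (\<forall>x\<in>topspace X. g (i' x) = i x)"
    using g(1) by blast
qed

text \<open>By maximality, applied in both directions, two presentations of \<open>T\<close> have
  the same subspace and the same map on it.\<close>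

lemma presents_kernel_unique:
  assumes "presents i T Z \<phi>" "presents i T Z' \<phi>'"
  shows "remainder_kernel Z \<phi> = remainder_kernel Z' \<phi>'"
proof -
  have "remainder_kernel Z \<phi> \<subseteq> remainder_kernel Z' \<phi>'"
    if pr: "presents i T Z \<phi>" "presents i T Z' \<phi>'" for Z Z' \<phi> \<phi>'
  proof -
    have "u \<in> Z' \<and> \<phi>' u = \<phi> u" if "u \<in> Z" for u
    proof (rule presents_maximal[OF pr(2) _ _ _ _ that])
      show "e ` topspace X \<subseteq> Z" "Z \<subseteq> topspace K" "continuous_map (subtopology K Z) T \<phi>"
        using pr(1) by (simp_all add: presents_def perfect_map_def)
      show "\<phi> (e x) = i x" if "x \<in> topspace X" for x
        using pr(1) that by (simp add: presents_def)
    qed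
    then show ?thesis
      by (auto simp: remainder_kernel_def)
  qed
  then show ?thesis
    using assms by blast
qed

lemma remainder_preimage:
  assumes pr: "presents i T Z \<phi>" and i: "embedding_map X T i"
  shows "Z - e ` topspace X = {u \<in> topspace (subtopology K Z). \<phi> u \<in> topspace T - i ` topspace X}"
proof -
  have ZK: "e ` topspace X \<subseteq> Z" "Z \<subseteq> topspace K" and \<phi>: "\<phi> ` Z = topspace T"
    and \<phi>i: "\<And>x. x \<in> topspace X \<Longrightarrow> \<phi> (e x) = i x"
    using pr by (auto simp: presents_def perfect_map_def Int_absorb1)
  have "u \<in> e ` topspace X" if "u \<in> Z" "\<phi> u \<in> i ` topspace X" for u
    using presents_fibre[OF pr i that(1)] that(2) by blast
  then show ?thesis
    using ZK \<phi> \<phi>i by auto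
qed

lemma compactin_remainder:
  assumes pr: "presents i T Z \<phi>" and i: "embedding_map X T i"
    and R: "compactin T (topspace T - i ` topspace X)"
  shows "compactin K (Z - e ` topspace X)"
proof -
  have "proper_map (subtopology K Z) T \<phi>"
    using pr by (simp add: presents_def perfect_map_def)
  then have "compactin (subtopology K Z) (Z - e ` topspace X)"
    unfolding remainder_preimage[OF pr i] using R by (rule compactin_proper_map_preimage)
  then show ?thesis
    by (simp add: compactin_subtopology)
qed

text \<open>The kernel is the coincidence set of two continuous maps from \<open>?D\<close> times
  \<open>?D\<close> into a Hausdorff space, and this product is closed because \<open>?D\<close> is
  compact.\<close>

lemma closedin_remainder_kernel:
  assumes pr: "presents i T Z \<phi>" and i: "embedding_map X T i" and T: "Hausdorff_space T"
    and R: "compactin T (topspace T - i ` topspace X)"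
  shows "closedin (prod_topology K K) (remainder_kernel Z \<phi>)"
proof -
  let ?D = "Z - e ` topspace X"
  have D: "closedin K ?D"
    using compactin_remainder[OF pr i R] Hausdorff_K compactin_imp_closedin by blast
  then have DK: "?D \<subseteq> topspace K"
    by (rule closedin_subset)
  let ?KD = "subtopology K ?D"
  have "continuous_map (subtopology K Z) T \<phi>"
    using pr by (simp add: presents_def perfect_map_def)
  then have "continuous_map (subtopology (subtopology K Z) ?D) T \<phi>"
    by (rule continuous_map_from_subtopology)
  moreover have "subtopology (subtopology K Z) ?D = ?KD"
    by (simp add: subtopology_subtopology inf.absorb2)
  ultimately have \<phi>: "continuous_map ?KD T \<phi>"
    by simp
  have "closedin (prod_topology ?KD ?KD) {p \<in> topspace (prod_topology ?KD ?KD). \<phi> (fst p) = \<phi> (snd p)}"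
    using closedin_continuous_maps_eq[OF T continuous_map_compose[OF continuous_map_fst \<phi>]
        continuous_map_compose[OF continuous_map_snd \<phi>]] by (simp add: o_def)
  moreover have "{p \<in> topspace (prod_topology ?KD ?KD). \<phi> (fst p) = \<phi> (snd p)} = remainder_kernel Z \<phi>"
    using DK by (auto simp: remainder_kernel_def)
  moreover have "prod_topology ?KD ?KD = subtopology (prod_topology K K) (?D \<times> ?D)"
    by (simp add: subtopology_Times)
  moreover have "closedin (prod_topology K K) (?D \<times> ?D)"
    using D by (simp add: closedin_prod_Times_iff)
  ultimately show ?thesis
    using closedin_trans_full[of "prod_topology K K" "?D \<times> ?D" "remainder_kernel Z \<phi>"] by simp
qed

end

section \<open>Quotients of compact Hausdorff spaces by closed equivalence relations\<close>

lemma ex_quotient_topology: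
  fixes q :: "'c \<Rightarrow> 't"
  obtains Q where "quotient_map K Q q" "topspace Q = q ` topspace K"
proof -
  define op where "op = (\<lambda>U. U \<subseteq> q ` topspace K \<and> openin K {u \<in> topspace K. q u \<in> U})"
  have "istopology op"
    unfolding istopology_def
  proof (intro conjI allI impI)
    fix S T assume "op S" "op T"
    moreover have "{u \<in> topspace K. q u \<in> S \<inter> T} =
        {u \<in> topspace K. q u \<in> S} \<inter> {u \<in> topspace K. q u \<in> T}"
      by blast
    ultimately show "op (S \<inter> T)"
      unfolding op_def by (auto intro: openin_Int)
  next
    fix \<U> assume \<U>: "\<forall>U\<in>\<U>. op U"
    have "{u \<in> topspace K. q u \<in> \<Union>\<U>} = \<Union>((\<lambda>U. {u \<in> topspace K. q u \<in> U}) ` \<U>)"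
      by blast
    then show "op (\<Union>\<U>)"
      using \<U> unfolding op_def by (auto intro!: openin_Union)
  qed
  then have op: "openin (topology op) U \<longleftrightarrow> op U" for U
    by (simp add: topology_inverse')
  have "{u \<in> topspace K. q u \<in> q ` topspace K} = topspace K"
    by blast
  then have "op (q ` topspace K)"
    unfolding op_def by simp
  then have top: "topspace (topology op) = q ` topspace K"
    using openin_subset[of "topology op" "q ` topspace K"] openin_topspace[of "topology op"]
    unfolding op by (auto simp: op_def)
  have "quotient_map K (topology op) q"
    unfolding quotient_map_def top op by (auto simp: op_def)
  then show ?thesis
    using that top by blast
qed

text \<open>The quotient map is closed because the saturation of a closed set \<open>C\<close> is the projection
  of the compact set of related pairs with first component in \<open>C\<close>.\<close>

lemma closed_kernel_quotient:
  fixes q :: "'c \<Rightarrow> 't"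
  assumes K: "compact_space K" "Hausdorff_space K"
    and q: "quotient_map K Q q"
    and E: "closedin (prod_topology K K) E"
    and ker: "\<And>u v. u \<in> topspace K \<Longrightarrow> v \<in> topspace K \<Longrightarrow> q u = q v \<longleftrightarrow> u = v \<or> (u, v) \<in> E"
  shows "perfect_map K Q q" "tychonoff Q"
proof -
  have cont: "continuous_map K Q q" and onto: "q ` topspace K = topspace Q"
    using q by (auto simp: quotient_imp_continuous_map quotient_imp_surjective_map)
  have EK: "E \<subseteq> topspace K \<times> topspace K"
    using closedin_subset[OF E] by simp
  have closed: "closed_map K Q q"
    unfolding closed_map_def
  proof (intro allI impI)
    fix C assume C: "closedin K C"
    then have CK: "C \<subseteq> topspace K"
      by (rule closedin_subset)
    have "closedin (prod_topology K K) (E \<inter> (C \<times> topspace K))"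
      using E C by (intro closedin_Int) (simp_all add: closedin_prod_Times_iff)
    then have "closedin K (snd ` (E \<inter> (C \<times> topspace K)))"
      using Abstract_Topological_Spaces.closed_map_snd[OF K(1), of K] unfolding closed_map_def by blast
    then have "closedin K (C \<union> snd ` (E \<inter> (C \<times> topspace K)))"
      using C by blast
    moreover have "{u \<in> topspace K. q u \<in> q ` C} = C \<union> snd ` (E \<inter> (C \<times> topspace K))"
    proof (intro set_eqI iffI)
      fix u assume "u \<in> {u \<in> topspace K. q u \<in> q ` C}"
      then obtain c where c: "u \<in> topspace K" "c \<in> C" "q c = q u"
        by auto
      then have "c = u \<or> (c, u) \<in> E"
        using ker[of c u] CK by blast
      then show "u \<in> C \<union> snd ` (E \<inter> (C \<times> topspace K))"
        using c by (auto intro: rev_image_eqI)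
    next
      fix u assume "u \<in> C \<union> snd ` (E \<inter> (C \<times> topspace K))"
      then consider "u \<in> C" | c where "c \<in> C" "(c, u) \<in> E"
        by auto
      then show "u \<in> {u \<in> topspace K. q u \<in> q ` C}"
      proof cases
        case 2
        then have "u \<in> topspace K" "q c = q u"
          using EK CK ker[of c u] by blast+
        then show ?thesis
          using 2(1) by (auto intro: rev_image_eqI)
      qed (use CK in blast)
    qed
    ultimately have "closedin K {u \<in> topspace K. q u \<in> q ` C}"
      by simp
    moreover have "q ` C \<subseteq> topspace Q"
      using CK onto by blast
    ultimately show "closedin Q (q ` C)"
      using q unfolding quotient_map_closedin by blast
  qed
  have t1: "t1_space Q"
    unfolding t1_space_closedin_singleton
  proof
    fix y assume "y \<in> topspace Q"
    then obtain u where "u \<in> topspace K" "y = q u"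
      using onto by blast
    moreover have "closedin K {u}"
      using K(2) \<open>u \<in> topspace K\<close> by (simp add: closedin_Hausdorff_singleton)
    ultimately show "closedin Q {y}"
      using closed unfolding closed_map_def by (metis image_insert image_empty)
  qed
  show "perfect_map K Q q"
    unfolding perfect_map_def
    using cont onto continuous_closed_imp_proper_map[OF K(1) t1 cont closed] by blast
  \<comment> \<open>Complete regularity of the quotient is reached through normality, which passes
    to closed continuous images.\<close>
  have "normal_space K"
    using K by (simp add: compact_Hausdorff_or_regular_imp_normal_space)
  then have "normal_space Q"
    using cont closed onto by (rule normal_space_continuous_closed_map_image)
  then show "tychonoff Q"
    using t1 by (simp add: tychonoff_def normal_t1_imp_Hausdorff_space normal_imp_completely_regular_space)
qed

section \<open>Extensions with a prescribed kernel\<close>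

context stone_cech_space
begin

text \<open>Maps \<open>K\<close> injectively into the type that carries the remainders of extensions.\<close>

definition point_code :: "'c \<Rightarrow> 'a set set" where
  "point_code u = {A. A \<subseteq> topspace X \<and> u \<in> K closure_of (e ` A)}"

text \<open>By density, \<open>u\<close> is in the closure of the trace on \<open>X\<close> of each
  of its neighbourhoods, whereas a point separated from that neighbourhood is not.\<close>

lemma inj_on_point_code: "inj_on point_code (topspace K)"
proof (rule inj_onI, rule ccontr)
  fix u v assume uv: "u \<in> topspace K" "v \<in> topspace K" "point_code u = point_code v" "u \<noteq> v"
  then obtain V W where VW: "openin K V" "openin K W" "u \<in> V" "v \<in> W" "disjnt V W"
    using Hausdorff_K[unfolded Hausdorff_space_def, rule_format, of u v] by blast
  let ?A = "{x \<in> topspace X. e x \<in> V}"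
  have "u \<in> K closure_of (e ` ?A)"
    unfolding in_closure_of
  proof (intro conjI allI impI)
    fix G assume G: "u \<in> G \<and> openin K G"
    then obtain x where "x \<in> topspace X" "e x \<in> G \<inter> V"
      using VW meets_dense[of "G \<inter> V" u] by blast
    then show "\<exists>y. y \<in> e ` ?A \<and> y \<in> G"
      by blast
  qed (fact uv(1))
  then have "?A \<in> point_code v"
    using uv(3) unfolding point_code_def by blast
  then have "v \<in> K closure_of (e ` ?A)"
    by (simp add: point_code_def)
  then obtain y where "y \<in> e ` ?A" "y \<in> W"
    using VW unfolding in_closure_of by blast
  then show False
    using VW(5) by (auto simp: disjnt_iff)
qed

text \<open>The classical bound by the double power set of \<open>X\<close>, from which the
  smallness of all spaces in the main argument is derived.\<close>

lemma topspace_lepoll: "topspace K \<lesssim> (UNIV :: 'a set set set)"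
  using inj_on_point_code by (auto simp: lepoll_def)

text \<open>Together with the diagonal of \<open>K\<close>, \<open>E\<close> is a closed equivalence
  relation on \<open>K\<close>. The extension is the image of \<open>Z\<close> in the compact
  Hausdorff quotient. As \<open>Z\<close> is saturated, the quotient map stays perfect over this
  image; as it is injective over \<open>X\<close>, it embeds \<open>X\<close>.\<close>

lemma ex_extension_with_kernel:
  assumes E: "closedin (prod_topology K K) E"
    and ES: "E \<subseteq> (topspace K - e ` topspace X) \<times> (topspace K - e ` topspace X)"
    and "sym E" "trans E"
  obtains T \<phi> where "is_extension X T" "presents Inl T (e ` topspace X \<union> {u. (u, u) \<in> E}) \<phi>"
    "remainder_kernel (e ` topspace X \<union> {u. (u, u) \<in> E}) \<phi> = E"
    "compactin T (topspace T - Inl ` topspace X)"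
    "topspace T - Inl ` topspace X = \<phi> ` {u. (u, u) \<in> E}"
proof -
  let ?eX = "e ` topspace X"
  define D where "D = {u. (u, u) \<in> E}"
  define Z where "Z = ?eX \<union> D"
  have DS: "D \<subseteq> topspace K - ?eX"
    using ES by (auto simp: D_def)
  have eXK: "?eX \<subseteq> topspace K"
    using e_in by blast
  have E_D: "u \<in> D \<and> v \<in> D" if "(u, v) \<in> E" for u v
    using that \<open>sym E\<close> \<open>trans E\<close> unfolding D_def by (blast dest: symD transD)
  \<comment> \<open>One representative is chosen per class of \<open>E\<close>; outside the domain
    \<open>D\<close> the map is the identity.\<close>
  define rep where "rep = (\<lambda>u. if u \<in> D then SOME v. (u, v) \<in> E else u)"
  have rep_E: "(u, rep u) \<in> E" if "u \<in> D" for u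
    using that someI[of "\<lambda>v. (u, v) \<in> E" u] by (simp add: rep_def D_def)
  have rep_iff: "rep u = rep v \<longleftrightarrow> u = v \<or> (u, v) \<in> E" for u v
  proof (cases "u \<in> D \<and> v \<in> D")
    case True
    show ?thesis
    proof
      assume "rep u = rep v"
      then have "(u, rep u) \<in> E" "(rep u, v) \<in> E"
        using rep_E[of u] rep_E[of v] True \<open>sym E\<close> by (auto dest: symD)
      then show "u = v \<or> (u, v) \<in> E"
        using \<open>trans E\<close> by (blast dest: transD)
    next
      assume "u = v \<or> (u, v) \<in> E"
      then have "(u, w) \<in> E \<longleftrightarrow> (v, w) \<in> E" for w
        using \<open>sym E\<close> \<open>trans E\<close> by (blast dest: symD transD)
      then show "rep u = rep v"
        using True by (simp add: rep_def)
    qed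
  next
    case False
    have "rep w \<in> D \<longleftrightarrow> w \<in> D" for w
      using rep_E E_D by (cases "w \<in> D") (auto simp: rep_def)
    moreover have "rep w = w" if "w \<notin> D" for w
      using that by (simp add: rep_def)
    ultimately have "rep u = rep v \<longleftrightarrow> u = v"
      using False by metis
    then show ?thesis
      using False E_D by blast
  qed
  have rep_K: "rep u \<in> topspace K" if "u \<in> topspace K" for u
    using that rep_E[of u] E_D[of u "rep u"] DS by (cases "u \<in> D") (auto simp: rep_def)
  \<comment> \<open>The points of the quotient are named inside the prescribed carrier type: points
    of \<open>X\<close> by themselves, every other class by the code of its representative.\<close>
  define q :: "'c \<Rightarrow> 'a + 'a set set" where
    "q = (\<lambda>u. if u \<in> ?eX then Inl (inv_into (topspace X) e u) else Inr (point_code (rep u)))"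
  have q_e: "q (e x) = Inl x" if "x \<in> topspace X" for x
    using that inj_e by (simp add: q_def)
  have q_iff: "q u = q v \<longleftrightarrow> u = v \<or> (u, v) \<in> E" if uv: "u \<in> topspace K" "v \<in> topspace K" for u v
  proof (cases "u \<in> ?eX \<or> v \<in> ?eX")
    case True
    then have "(u, v) \<notin> E"
      using ES by blast
    moreover have "u = v" if "q u = q v"
    proof -
      have "u \<in> ?eX" "v \<in> ?eX"
        using True that by (auto simp: q_def split: if_splits)
      then show ?thesis
        using that q_e by auto
    qed
    ultimately show ?thesis
      by blast
  next
    case False
    then have "q u = q v \<longleftrightarrow> rep u = rep v"
      using rep_K uv inj_on_point_code by (auto simp: q_def inj_on_def)
    then show ?thesis
      using rep_iff by simp
  qed
  obtain Q where Q: "quotient_map K Q q" "topspace Q = q ` topspace K"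
    by (rule ex_quotient_topology)
  note Qp = closed_kernel_quotient[OF compact_K Hausdorff_K Q(1) E q_iff]
  define T where "T = subtopology Q (q ` Z)"
  have ZK: "Z \<subseteq> topspace K"
    using eXK DS by (auto simp: Z_def)
  have sat: "{u \<in> topspace K. q u \<in> q ` Z} = Z"
  proof -
    have "u \<in> Z" if u: "u \<in> topspace K" "v \<in> Z" "q u = q v" for u v
    proof -
      have "u = v \<or> (u, v) \<in> E"
        using u ZK q_iff by blast
      then show ?thesis
        using u(2) E_D unfolding Z_def by blast
    qed
    then show ?thesis
      using ZK by blast
  qed
  have perf: "perfect_map (subtopology K Z) T q"
    unfolding T_def using Qp(1) sat by (rule perfect_map_restriction)
  then have pr: "presents Inl T Z q"
    unfolding presents_def using ZK q_e by (auto simp: Z_def)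
  have topT: "topspace T = q ` Z"
    using perf ZK by (simp add: perfect_map_def Int_absorb1)
  have q_eX: "q ` ?eX = Inl ` topspace X"
    using q_e by (simp add: image_image)
  have q_D: "q ` D \<inter> range Inl = {}"
    using DS by (auto simp: q_def)
  have sat_eX: "{u \<in> topspace K. q u \<in> Inl ` topspace X} = ?eX"
    using q_e eXK by (auto simp: q_def split: if_splits)
  \<comment> \<open>The image of \<open>X\<close> is itself saturated, so the restriction of
    \<open>q\<close> to it is perfect, and an injective perfect map is a homeomorphism.\<close>
  have "perfect_map (subtopology K ?eX) (subtopology Q (Inl ` topspace X)) q"
    using Qp(1) sat_eX by (rule perfect_map_restriction)
  moreover have "inj_on q (topspace (subtopology K ?eX))"
    using q_e by (auto simp: inj_on_def)
  ultimately have "homeomorphic_map (subtopology K ?eX) (subtopology Q (Inl ` topspace X)) q"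
    by (simp add: homeomorphic_eq_injective_perfect_map)
  moreover have "homeomorphic_map X (subtopology K ?eX) e"
    using embedding_e by (simp add: embedding_map_def)
  ultimately have "homeomorphic_map X (subtopology Q (Inl ` topspace X)) (q \<circ> e)"
    by (rule homeomorphic_map_compose[rotated])
  then have "homeomorphic_map X (subtopology Q (Inl ` topspace X)) Inl"
    by (rule homeomorphic_map_eq) (simp add: q_e)
  then have "embedding_map X Q Inl"
    by (simp add: embedding_map_def)
  then have emb: "embedding_map X T Inl"
    unfolding T_def embedding_map_in_subtopology using q_eX by (auto simp: Z_def)
  have "(subtopology K Z) closure_of ?eX = Z"
    using dense_e ZK by (auto simp: closure_of_subtopology Z_def Int_absorb1 Int_absorb2)
  then have "q ` Z \<subseteq> T closure_of (Inl ` topspace X)"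
    using continuous_map_image_closure_subset[OF perfect_imp_continuous_map[OF perf], of ?eX] q_eX
    by simp
  then have dense: "T closure_of (Inl ` topspace X) = topspace T"
    using topT closure_of_subset_topspace[of T] by blast
  have rem: "topspace T - Inl ` topspace X = q ` D"
    using topT q_eX q_D by (auto simp: Z_def image_Un)
  have ext: "is_extension X T"
    unfolding is_extension_def
  proof (intro conjI)
    show "tychonoff T"
      unfolding T_def using Qp(2) by (rule tychonoff_subtopology)
    show "topspace T \<inter> range Inl = Inl ` topspace X"
      using topT q_eX q_D by (auto simp: Z_def image_Un)
  qed (fact emb dense)+
  \<comment> \<open>The domain of \<open>E\<close> is the preimage of the closed set
    \<open>E\<close> under the diagonal map.\<close>
  have "closedin K {u \<in> topspace K. (u, u) \<in> E}"
    by (rule closedin_continuous_map_preimage[OF _ E]) (simp add: continuous_map_pairedI)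
  moreover have "{u \<in> topspace K. (u, u) \<in> E} = D"
    using DS by (auto simp: D_def)
  ultimately have "compactin K D"
    using closedin_compact_space[OF compact_K] by simp
  then have "compactin (subtopology K Z) D"
    by (auto simp: compactin_subtopology Z_def)
  then have comp: "compactin T (topspace T - Inl ` topspace X)"
    unfolding rem using image_compactin perfect_imp_continuous_map[OF perf] by blast
  have ZD: "Z - ?eX = D"
    using DS by (auto simp: Z_def)
  have "q u = q v \<longleftrightarrow> (u, v) \<in> E" if "u \<in> D" "v \<in> D" for u v
    using q_iff[of u v] that DS unfolding D_def by blast
  then have "remainder_kernel Z q = E"
    unfolding remainder_kernel_def ZD using E_D by blast
  then show ?thesis
    using that[of T q] ext pr comp rem unfolding Z_def D_def by blast
qed

end

section \<open>Extensions with the property and the set lambda\<close>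

lemma embedding_map_subtopology_homeomorphic:
  assumes f: "embedding_map Z W f" and A: "A \<subseteq> topspace Z"
  shows "subtopology Z A homeomorphic_space subtopology W (f ` A)"
proof -
  have h: "homeomorphic_map Z (subtopology W (f ` topspace Z)) f"
    using f by (simp add: embedding_map_def)
  have "f ` A \<subseteq> topspace (subtopology W (f ` topspace Z))"
    using A unfolding homeomorphic_imp_surjective_map[OF h, symmetric] by (rule image_mono)
  then have "f ` (topspace Z \<inter> A) = topspace (subtopology W (f ` topspace Z)) \<inter> f ` A"
    using A by (simp add: Int_absorb1)
  then have "homeomorphic_map (subtopology Z A) (subtopology (subtopology W (f ` topspace Z)) (f ` A)) f"
    by (rule homeomorphic_map_subtopologies[OF h])
  moreover have "subtopology (subtopology W (f ` topspace Z)) (f ` A) = subtopology W (f ` A)"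
    using A by (simp add: subtopology_subtopology image_mono inf.absorb2)
  ultimately show ?thesis
    using homeomorphic_map_imp_homeomorphic_space by simp
qed

lemma cozero_setsI:
  "continuous_map X euclideanreal f \<Longrightarrow> {x \<in> topspace X. f x \<noteq> 0} \<in> cozero_sets X"
  unfolding cozero_sets_def by (rule CollectI, rule exI[of _ f]) simp

lemma (in stone_cech_space) e_closure_of:
  assumes "C \<subseteq> topspace X"
  shows "e ` (X closure_of C) = e ` topspace X \<inter> K closure_of (e ` C)"
proof -
  have "homeomorphic_map X (subtopology K (e ` topspace X)) e"
    using embedding_e by (simp add: embedding_map_def)
  then have "e ` (X closure_of C) = subtopology K (e ` topspace X) closure_of (e ` C)"
    using assms by (simp add: homeomorphic_map_closure_of)
  also have "\<dots> = e ` topspace X \<inter> K closure_of (e ` C)"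
    using assms by (simp add: closure_of_subtopology image_mono inf.absorb2)
  finally show ?thesis .
qed

locale non_P_space = compactness_like_property P + stone_cech_space X K e
  for P :: "'u topology \<Rightarrow> bool" and X :: "'a topology" and K :: "'c topology" and e :: "'a \<Rightarrow> 'c" +
  assumes tychonoff_X: "tychonoff X" and locally_compact_X: "locally_compact_space X"
    and locally_P_X: "locally_P P X" and not_P_X: "\<not> hasP P X"
    and small_K: "topspace K \<lesssim> (UNIV :: 'u set)"
begin

text \<open>These are the sets S (\<open>remainder\<close>) and F (\<open>core\<close>) of the
  overview.\<close>

definition remainder where "remainder = topspace K - e ` topspace X"

definition core where "core = topspace K - lambdaP P X K e"

lemma small_subtopology: "topspace (subtopology K A) \<lesssim> (UNIV :: 'u set)"
  using small_K subset_imp_lepoll[of "topspace (subtopology K A)" "topspace K"] lepoll_trans by auto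

lemma tychonoff_K: "tychonoff K"
  using compact_K Hausdorff_K
  by (simp add: tychonoff_def normal_imp_completely_regular_space
      compact_Hausdorff_or_regular_imp_normal_space)

lemma small_X: "topspace X \<lesssim> (UNIV :: 'u set)"
proof -
  have "topspace X \<lesssim> topspace K"
    using inj_e e_in by (auto simp: lepoll_def)
  then show ?thesis
    using small_K lepoll_trans by blast
qed

lemma openin_eX: "openin K (e ` topspace X)"
proof (rule dense_locally_compact_openin_Hausdorff_space[OF Hausdorff_K _ dense_e])
  show "e ` topspace X \<subseteq> topspace K"
    using e_in by blast
  show "locally_compact_space (subtopology K (e ` topspace X))"
    using locally_compact_X homeomorphic_locally_compact_space[OF embedding_map_imp_homeomorphic_space[OF embedding_e]]
    by simp
qed

lemma closedin_remainder: "closedin K remainder"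
  using openin_eX unfolding remainder_def by blast

lemma openin_lambda: "openin K (lambdaP P X K e)"
  unfolding lambdaP_def by (rule openin_Union) auto

lemma closedin_core: "closedin K core"
  using openin_lambda unfolding core_def by blast

text \<open>The complement of \<open>G\<close> is a compact subset of \<lambda>, so finitely many of
  the interiors that define \<lambda> cover it. The part of \<open>X\<close> outside
  \<open>G\<close> is therefore a closed subset of a finite union of closed subspaces with
  \<open>P\<close>.\<close>

lemma hasP_outside:
  assumes G: "openin K G" "core \<subseteq> G"
  shows "hasP P (subtopology X {x \<in> topspace X. e x \<notin> G})"
proof -
  let ?\<C> = "{C \<in> cozero_sets X. hasP P (subtopology X (X closure_of C))}"
  let ?I = "\<lambda>C. K interior_of (K closure_of (e ` C))"
  have "closedin K (topspace K - G)"
    using G by blast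
  then have "compactin K (topspace K - G)"
    using closedin_compact_space[OF compact_K] by blast
  moreover have "\<forall>U \<in> ?I ` ?\<C>. openin K U"
    by auto
  moreover have "topspace K - G \<subseteq> \<Union>(?I ` ?\<C>)"
    using G(2) unfolding core_def lambdaP_def by blast
  ultimately have "\<exists>\<F>. finite \<F> \<and> \<F> \<subseteq> ?I ` ?\<C> \<and> topspace K - G \<subseteq> \<Union>\<F>"
    unfolding compactin_def by blast
  then obtain \<F> where \<F>: "finite \<F>" "\<F> \<subseteq> ?\<C>" "topspace K - G \<subseteq> \<Union>(?I ` \<F>)"
    by (metis (no_types, lifting) finite_subset_image)
  have CX: "C \<subseteq> topspace X" if "C \<in> \<F>" for C
    using that \<F>(2) by (auto simp: cozero_sets_def)
  let ?M = "\<Union>((\<lambda>C. X closure_of C) ` \<F>)"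
  let ?A = "{x \<in> topspace X. e x \<notin> G}"
  have M: "hasP P (subtopology X ?M)"
    using \<F> by (intro hasP_closed_Union[OF tychonoff_X small_X]) auto
  have "?A \<subseteq> ?M"
  proof
    fix x assume x: "x \<in> ?A"
    then have "e x \<in> topspace K - G"
      using e_in by simp
    then obtain C where C: "C \<in> \<F>" "e x \<in> ?I C"
      using \<F>(3) by blast
    then have "e x \<in> e ` topspace X \<inter> K closure_of (e ` C)"
      using x interior_of_subset[of K "K closure_of (e ` C)"] by blast
    then have "e x \<in> e ` (X closure_of C)"
      using e_closure_of[OF CX[OF C(1)]] by simp
    then have "x \<in> X closure_of C"
      using x inj_e closure_of_subset_topspace[of X C] by (auto simp: inj_on_def)
    then show "x \<in> ?M"
      using C(1) by blast
  qed
  moreover have "closedin X ?A"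
  proof -
    have "?A = {x \<in> topspace X. e x \<in> topspace K - G}"
      using e_in by auto
    then show ?thesis
      using closedin_continuous_map_preimage[OF continuous_e \<open>closedin K (topspace K - G)\<close>] by simp
  qed
  ultimately have "closedin (subtopology X ?M) ?A"
    by (simp add: closedin_subset_topspace)
  moreover have "topspace (subtopology X ?M) \<lesssim> (UNIV :: 'u set)"
    using small_X subset_imp_lepoll[of "topspace (subtopology X ?M)" "topspace X"] lepoll_trans by auto
  ultimately have "hasP P (subtopology (subtopology X ?M) ?A)"
    using hasP_closed[OF tychonoff_subtopology[OF tychonoff_X] _ M] by blast
  moreover have "subtopology (subtopology X ?M) ?A = subtopology X ?A"
    using \<open>?A \<subseteq> ?M\<close> by (simp add: subtopology_subtopology Int_absorb1)
  ultimately show ?thesis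
    by simp
qed

text \<open>If \<open>core\<close> were empty, then \<open>hasP_outside\<close> with the empty open
  set would give \<open>P\<close> to all of \<open>X\<close>.\<close>

lemma core_nonempty: "core \<noteq> {}"
proof
  assume "core = {}"
  then have "hasP P (subtopology X {x \<in> topspace X. e x \<notin> {}})"
    by (intro hasP_outside) auto
  then show False
    using not_P_X by simp
qed

text \<open>Being locally \<open>P\<close>, together with complete regularity, gives each point of
  \<open>X\<close> a cozero neighbourhood whose closure has \<open>P\<close>. Since \<open>X\<close>
  is open in \<open>K\<close>, this neighbourhood is open in \<open>K\<close> and lies in the
  interior of its closure.\<close>

lemma core_subset_remainder: "core \<subseteq> remainder"
proof -
  have "e x \<in> lambdaP P X K e" if x: "x \<in> topspace X" for x
  proof -
    obtain U where U: "openin X U" "x \<in> U" "hasP P (subtopology X (X closure_of U))"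
      using locally_P_X x unfolding locally_P_def by blast
    have "completely_regular_space X"
      using tychonoff_X by (simp add: tychonoff_def)
    then obtain f where f: "continuous_map X euclideanreal f" "f x = 0" "f ` (topspace X - U) \<subseteq> {1}"
      using U unfolding completely_regular_space_alt' by blast
    \<comment> \<open>The function \<open>f\<close> is 0 at \<open>x\<close> and 1 outside
      \<open>U\<close>, so shifting it by 1 makes a cozero set that contains \<open>x\<close> and
      stays in \<open>U\<close>.\<close>
    let ?C = "{y \<in> topspace X. f y - 1 \<noteq> 0}"
    have "continuous_map X euclideanreal (\<lambda>y. f y - 1)"
      using f(1) by (intro continuous_intros) auto
    then have coz: "?C \<in> cozero_sets X"
      by (rule cozero_setsI)
    have "?C \<subseteq> U"
      using f(3) by auto
    have "openin X {y \<in> topspace X. f y \<in> - {1}}"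
      using f(1) by (rule openin_continuous_map_preimage) auto
    moreover have "{y \<in> topspace X. f y \<in> - {1}} = ?C"
      by auto
    ultimately have "openin X ?C"
      by simp
    then have "openin (subtopology K (e ` topspace X)) (e ` ?C)"
      using embedding_e homeomorphic_imp_open_map unfolding embedding_map_def open_map_def by blast
    then have op: "openin K (e ` ?C)"
      using openin_eX by (rule openin_trans_full)
    have "e ` ?C \<subseteq> K closure_of (e ` ?C)"
      using openin_subset[OF op] by (rule closure_of_subset)
    then have "e ` ?C \<subseteq> K interior_of (K closure_of (e ` ?C))"
      using op by (simp add: interior_of_maximal)
    moreover have "x \<in> ?C"
      using f(2) x by simp
    ultimately have int: "e x \<in> K interior_of (K closure_of (e ` ?C))"
      by blast
    let ?M = "X closure_of U"
    have sub: "X closure_of ?C \<subseteq> ?M"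
      using \<open>?C \<subseteq> U\<close> by (rule closure_of_mono)
    then have "closedin (subtopology X ?M) (X closure_of ?C)"
      by (simp add: closedin_subset_topspace)
    moreover have "topspace (subtopology X ?M) \<lesssim> (UNIV :: 'u set)"
      using small_X subset_imp_lepoll[of "topspace (subtopology X ?M)" "topspace X"] lepoll_trans by auto
    ultimately have "hasP P (subtopology (subtopology X ?M) (X closure_of ?C))"
      using hasP_closed[OF tychonoff_subtopology[OF tychonoff_X] _ U(3)] by blast
    then have "hasP P (subtopology X (X closure_of ?C))"
      using sub by (simp add: subtopology_subtopology Int_absorb1)
    then show ?thesis
      using coz int unfolding lambdaP_def by blast
  qed
  then show ?thesis
    unfolding core_def remainder_def by auto
qed

text \<open>A point \<open>u\<close> outside \<open>D\<close> has a neighbourhood in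
  \<open>K\<close> whose closure misses \<open>D\<close>. The trace of this closure on
  \<open>X\<close> together with \<open>D\<close> lies in \<open>X\<close> alone and is closed
  there, so it has \<open>P\<close>; this puts \<open>u\<close> into \<lambda>.\<close>

lemma core_subset_if_hasP:
  assumes D: "closedin K D" "D \<subseteq> remainder" and P: "hasP P (subtopology K (e ` topspace X \<union> D))"
  shows "core \<subseteq> D"
proof
  fix u assume u: "u \<in> core"
  show "u \<in> D"
  proof (rule ccontr)
    assume "u \<notin> D"
    let ?Z = "e ` topspace X \<union> D"
    have uK: "u \<in> topspace K" and "u \<notin> lambdaP P X K e"
      using u by (auto simp: core_def)
    have "completely_regular_space K"
      using tychonoff_K by (simp add: tychonoff_def)
    then obtain f where f: "continuous_map K euclideanreal f" "f u = 0" "f ` D \<subseteq> {1}"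
      using D(1) uK \<open>u \<notin> D\<close> unfolding completely_regular_space_alt by blast
    \<comment> \<open>This writes the sublevel set of \<open>f\<close> below 1/2 as a cozero set.
      The level 1/2 leaves a gap to the value 1 on \<open>D\<close>, so that even the closure in
      \<open>K\<close> avoids \<open>D\<close>.\<close>
    let ?C = "{x \<in> topspace X. max 0 (1/2 - f (e x)) \<noteq> 0}"
    have "continuous_map X euclideanreal (\<lambda>x. max 0 (1/2 - f (e x)))"
      using continuous_map_compose[OF continuous_e f(1)]
      by (intro continuous_map_real_max continuous_map_diff) (auto simp: o_def)
    then have coz: "?C \<in> cozero_sets X"
      by (rule cozero_setsI)
    have CX: "?C \<subseteq> topspace X"
      by blast
    have "closedin K {v \<in> topspace K. f v \<in> {..1/2}}"
      using f(1) by (rule closedin_continuous_map_preimage) auto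
    moreover have "e ` ?C \<subseteq> {v \<in> topspace K. f v \<in> {..1/2}}"
      using e_in by (auto simp: max_def split: if_splits)
    ultimately have cl: "K closure_of (e ` ?C) \<subseteq> {v \<in> topspace K. f v \<in> {..1/2}}"
      by (simp only: closure_of_minimal)
    then have "D \<inter> K closure_of (e ` ?C) = {}"
      using f(3) by force
    then have eq: "e ` (X closure_of ?C) = ?Z \<inter> K closure_of (e ` ?C)"
      using e_closure_of[OF CX] by blast
    have "closedin (subtopology K ?Z) (e ` (X closure_of ?C))"
      unfolding eq by (simp add: closedin_subtopology_Int_closed)
    then have "hasP P (subtopology (subtopology K ?Z) (e ` (X closure_of ?C)))"
      by (rule hasP_closed[OF tychonoff_subtopology[OF tychonoff_K] small_subtopology P])
    moreover have "subtopology (subtopology K ?Z) (e ` (X closure_of ?C)) = subtopology K (e ` (X closure_of ?C))"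
      unfolding eq by (simp add: subtopology_subtopology)
    moreover have hom: "subtopology X (X closure_of ?C) homeomorphic_space subtopology K (e ` (X closure_of ?C))"
      using embedding_e closure_of_subset_topspace by (rule embedding_map_subtopology_homeomorphic)
    ultimately have hP: "hasP P (subtopology X (X closure_of ?C))"
      unfolding hasP_homeomorphic[OF hom] by simp
    let ?G = "{v \<in> topspace K. f v \<in> {..<1/2}}"
    have G: "openin K ?G"
      using f(1) by (rule openin_continuous_map_preimage) auto
    have "?G \<subseteq> K closure_of (e ` ?C)"
    proof
      \<comment> \<open>An open subset of \<open>K\<close> lies in the closure of its trace on the
        dense subspace \<open>X\<close>.\<close>
      fix v assume v: "v \<in> ?G"
      show "v \<in> K closure_of (e ` ?C)"
        unfolding in_closure_of
      proof (intro conjI allI impI)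
        fix H assume "v \<in> H \<and> openin K H"
        then obtain x where x: "x \<in> topspace X" "e x \<in> H \<inter> ?G"
          using meets_dense[of "H \<inter> ?G" v] G v by blast
        then have "x \<in> ?C"
          by auto
        then show "\<exists>y. y \<in> e ` ?C \<and> y \<in> H"
          using x by blast
      qed (use v in simp)
    qed
    then have "?G \<subseteq> K interior_of (K closure_of (e ` ?C))"
      using G by (simp only: interior_of_maximal)
    then have "u \<in> K interior_of (K closure_of (e ` ?C))"
      using uK f(2) by auto
    then have "u \<in> lambdaP P X K e"
      using coz hP unfolding lambdaP_def by blast
    then show False
      using \<open>u \<notin> lambdaP P X K e\<close> by blast
  qed
qed

text \<open>Collapsing \<open>D\<close> gives an extension with one added point. An open
  neighbourhood of that point pulls back to a set containing \<open>D\<close>, hence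
  \<open>core\<close>, so its complement is a part of \<open>X\<close> that has \<open>P\<close> by
  \<open>hasP_outside\<close>. Inverse invariance then returns from the collapsed space to
  \<open>X\<close> with \<open>D\<close> adjoined.\<close>

lemma hasP_if_core_subset:
  assumes D: "closedin K D" "D \<subseteq> remainder" "core \<subseteq> D"
  shows "hasP P (subtopology K (e ` topspace X \<union> D))"
proof -
  have E: "closedin (prod_topology K K) (D \<times> D)"
    using D(1) by (simp add: closedin_prod_Times_iff)
  have DD: "{u. (u, u) \<in> D \<times> D} = D"
    by auto
  obtain T \<phi> where T: "is_extension X T" "presents Inl T (e ` topspace X \<union> D) \<phi>"
    "remainder_kernel (e ` topspace X \<union> D) \<phi> = D \<times> D"
    "topspace T - Inl ` topspace X = \<phi> ` D"
    using ex_extension_with_kernel[OF E] D(2) unfolding remainder_def DD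
    by (metis Sigma_mono symI transI mem_Sigma_iff)
  let ?Z = "e ` topspace X \<union> D"
  have perf: "perfect_map (subtopology K ?Z) T \<phi>" and \<phi>i: "\<And>x. x \<in> topspace X \<Longrightarrow> \<phi> (e x) = Inl x"
    and ZK: "?Z \<subseteq> topspace K"
    using T(2) by (auto simp: presents_def)
  have topZ: "topspace (subtopology K ?Z) = ?Z"
    using ZK by (simp add: Int_absorb1)
  have emb: "embedding_map X T Inl" and tych: "tychonoff T"
    using T(1) by (auto simp: is_extension_def)
  \<comment> \<open>\<open>D\<close> contains the nonempty \<open>core\<close>, so there is an added
    point at which (W) can be applied.\<close>
  obtain d where d: "d \<in> D"
    using core_nonempty D(3) by blast
  have \<phi>D: "\<phi> u = \<phi> d" if "u \<in> D" for u
    using that d T(3) unfolding remainder_kernel_def by blast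
  have "\<phi> ` D = {\<phi> d}"
  proof
    show "\<phi> ` D \<subseteq> {\<phi> d}"
      by (rule image_subsetI) (simp only: \<phi>D singletonI)
  qed (use d in blast)
  then have rem: "topspace T - Inl ` topspace X = {\<phi> d}"
    using T(4) by simp
  have "hasP P T"
  proof (rule hasP_Mrowka[OF tych])
    show "topspace T \<lesssim> (UNIV :: 'u set)"
      using perf lepoll_trans[OF image_lepoll[of \<phi> "topspace (subtopology K ?Z)"] small_subtopology]
      unfolding perfect_map_def by simp
    show "\<phi> d \<in> topspace T"
      using rem by blast
    fix B assume B: "openin T B" "\<phi> d \<in> B"
    let ?A = "{x \<in> topspace X. Inl x \<notin> B}"
    have "topspace T - B = Inl ` ?A"
    proof -
      have "Inl ` topspace X \<subseteq> topspace T"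
        using T(1) unfolding is_extension_def by blast
      then have "Inl ` ?A \<subseteq> topspace T - B"
        by auto
      moreover have "t \<in> Inl ` ?A" if t: "t \<in> topspace T - B" for t
      proof -
        have "t \<notin> topspace T - Inl ` topspace X"
          unfolding rem using t B(2) by auto
        then show ?thesis
          using t by auto
      qed
      ultimately show ?thesis
        by (intro antisym subsetI) auto
    qed
    have "openin (subtopology K ?Z) {z \<in> topspace (subtopology K ?Z). \<phi> z \<in> B}"
      using perfect_imp_continuous_map[OF perf] B(1) by (rule openin_continuous_map_preimage)
    then obtain G where G: "openin K G" "{z \<in> ?Z. \<phi> z \<in> B} = ?Z \<inter> G"
      unfolding topZ by (auto simp: openin_subtopology Int_commute)
    have "\<phi> u \<in> B" if "u \<in> D" for u
      unfolding \<phi>D[OF that] by (rule B(2))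
    then have "D \<subseteq> {z \<in> ?Z. \<phi> z \<in> B}"
      by blast
    then have "core \<subseteq> G"
      using G(2) D(3) by blast
    then have "hasP P (subtopology X {x \<in> topspace X. e x \<notin> G})"
      by (rule hasP_outside[OF G(1)])
    moreover have "{x \<in> topspace X. e x \<notin> G} = ?A"
    proof -
      have "e x \<in> G \<longleftrightarrow> Inl x \<in> B" if "x \<in> topspace X" for x
      proof -
        have "e x \<in> {z \<in> ?Z. \<phi> z \<in> B} \<longleftrightarrow> e x \<in> ?Z \<inter> G"
          by (simp only: G(2))
        then show ?thesis
          using that \<phi>i[OF that] by simp
      qed
      then show ?thesis
        by blast
    qed
    ultimately have "hasP P (subtopology X ?A)"
      by simp
    moreover have hom: "subtopology X ?A homeomorphic_space subtopology T (Inl ` ?A)"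
      by (rule embedding_map_subtopology_homeomorphic[OF emb]) blast
    ultimately show "hasP P (subtopology T (topspace T - B))"
      unfolding \<open>topspace T - B = Inl ` ?A\<close> hasP_homeomorphic[OF hom, symmetric] by simp
  qed
  then show ?thesis
    using hasP_perfect[OF tychonoff_subtopology[OF tychonoff_K] tych perf small_subtopology] by simp
qed

end

section \<open>The poset of closed partial equivalence relations\<close>

text \<open>The least element is described by its order property alone, so that the notion is
  visibly preserved by order isomorphisms.\<close>

definition atom_in :: "'q set set \<Rightarrow> 'q set \<Rightarrow> bool" where
  "atom_in Q a \<longleftrightarrow> a \<in> Q \<and> \<not> (\<forall>r\<in>Q. a \<subseteq> r) \<and> (\<forall>q\<in>Q. q \<subseteq> a \<longrightarrow> q = a \<or> (\<forall>r\<in>Q. q \<subseteq> r))"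

text \<open>An order-theoretic substitute for "adjoins one point to the domain", justified by
  \<open>point_atom_iff\<close>.\<close>

definition point_atom :: "'q set set \<Rightarrow> 'q set \<Rightarrow> bool" where
  "point_atom Q a \<longleftrightarrow> atom_in Q a \<and> (\<exists>c\<in>Q. a \<subset> c \<and> (\<forall>b\<in>Q. atom_in Q b \<and> b \<subseteq> c \<longrightarrow> b = a))"

lemma point_atom_order_iso:
  assumes bij: "bij_betw \<psi> Q Q'"
    and iso: "\<And>q r. q \<in> Q \<Longrightarrow> r \<in> Q \<Longrightarrow> q \<subseteq> r \<longleftrightarrow> \<psi> q \<subseteq> \<psi> r"
    and a: "a \<in> Q"
  shows "point_atom Q a \<longleftrightarrow> point_atom Q' (\<psi> a)"
proof -
  have Q': "Q' = \<psi> ` Q" and inj: "\<And>q r. q \<in> Q \<Longrightarrow> r \<in> Q \<Longrightarrow> \<psi> q = \<psi> r \<longleftrightarrow> q = r"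
    using bij by (auto simp: bij_betw_def inj_on_def)
  have atom: "atom_in Q' (\<psi> b) \<longleftrightarrow> atom_in Q b" if "b \<in> Q" for b
    unfolding atom_in_def Q' using that by (simp add: inj flip: iso cong: ball_cong)
  show ?thesis
    unfolding point_atom_def psubset_eq atom[OF a] Q' bex_simps ball_simps
    using a by (simp add: inj atom flip: iso Q' cong: ball_cong bex_cong)
qed

text \<open>Reflexivity is required on the domain only, that is, on the points \<open>u\<close> with
  \<open>(u, u) \<in> E\<close>; symmetry and transitivity provide it there. The last condition says
  that the domain contains \<open>F\<close>.\<close>

definition closed_pers :: "'c topology \<Rightarrow> 'c set \<Rightarrow> 'c set \<Rightarrow> 'c rel set" where
  "closed_pers K S F =
     {E. closedin (prod_topology K K) E \<and> sym E \<and> trans E \<and> E \<subseteq> S \<times> S \<and> Id_on F \<subseteq> E}"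

lemma closed_pers_diag:
  assumes "E \<in> closed_pers K S F" "(u, v) \<in> E"
  shows "(u, u) \<in> E" "(v, v) \<in> E" "(v, u) \<in> E"
  using assms unfolding closed_pers_def by (blast dest: symD transD)+

locale compact_pair =
  fixes K :: "'c topology" and S F :: "'c set"
  assumes Hausdorff: "Hausdorff_space K" and closed_S: "closedin K S" and closed_F: "closedin K F"
    and FS: "F \<subseteq> S" and F_nonempty: "F \<noteq> {}"
begin

abbreviation "Q \<equiv> closed_pers K S F"

lemma SK: "S \<subseteq> topspace K"
  using closed_S closedin_subset by blast

lemma closedin_Id_on:
  assumes D: "closedin K D"
  shows "closedin (prod_topology K K) (Id_on D)"
proof -
  have "Id_on D = (\<lambda>x. (x, x)) ` topspace K \<inter> (D \<times> D)"
    using closedin_subset[OF D] by auto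
  moreover have "closedin (prod_topology K K) ((\<lambda>x. (x, x)) ` topspace K)"
    using Hausdorff by (simp add: Hausdorff_space_closedin_diagonal)
  ultimately show ?thesis
    using D by (simp add: closedin_Int closedin_prod_Times_iff)
qed

lemma Id_on_in_Q: "closedin K D \<Longrightarrow> F \<subseteq> D \<Longrightarrow> D \<subseteq> S \<Longrightarrow> Id_on D \<in> Q"
  using closedin_Id_on by (auto simp: closed_pers_def sym_def trans_def)

lemma closedin_insert: "x \<in> S \<Longrightarrow> closedin K (insert x F)"
  using closedin_Un[OF closedin_Hausdorff_singleton[OF Hausdorff] closed_F, of x] SK by auto

lemma point_in_Q: "x \<in> S \<Longrightarrow> Id_on (insert x F) \<in> Q"
  using Id_on_in_Q[OF closedin_insert] FS by blast

lemma identification_in_Q: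
  assumes D: "closedin K D" "F \<subseteq> D" "D \<subseteq> S" and xy: "x \<in> D" "y \<in> D"
  shows "Id_on D \<union> {(x, y), (y, x)} \<in> Q"
proof -
  have "closedin K {x}" "closedin K {y}"
    using xy D(3) SK closedin_Hausdorff_singleton[OF Hausdorff] by blast+
  then have "closedin (prod_topology K K) ({x} \<times> {y})" "closedin (prod_topology K K) ({y} \<times> {x})"
    unfolding closedin_prod_Times_iff by simp_all
  then have "closedin (prod_topology K K) (Id_on D \<union> ({x} \<times> {y} \<union> {y} \<times> {x}))"
    using closedin_Id_on[OF D(1)] by (intro closedin_Un)
  moreover have "Id_on D \<union> ({x} \<times> {y} \<union> {y} \<times> {x}) = Id_on D \<union> {(x, y), (y, x)}"
    by blast
  moreover have "sym (Id_on D \<union> {(x, y), (y, x)})"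
    by (auto simp: sym_def)
  moreover have "trans (Id_on D \<union> {(x, y), (y, x)})"
    using xy by (auto simp: trans_def)
  moreover have "Id_on D \<union> {(x, y), (y, x)} \<subseteq> S \<times> S"
    using xy D(3) by auto
  moreover have "Id_on F \<subseteq> Id_on D \<union> {(x, y), (y, x)}"
    using D(2) by auto
  ultimately show ?thesis
    unfolding closed_pers_def by simp
qed

lemma bottom: "q \<in> Q \<Longrightarrow> (\<forall>r\<in>Q. q \<subseteq> r) \<longleftrightarrow> q = Id_on F"
proof
  assume q: "q \<in> Q" and "\<forall>r\<in>Q. q \<subseteq> r"
  then have "q \<subseteq> Id_on F"
    using Id_on_in_Q[OF closed_F] FS by blast
  then show "q = Id_on F"
    using q unfolding closed_pers_def by blast
next
  assume "q = Id_on F"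
  then show "\<forall>r\<in>Q. q \<subseteq> r"
    unfolding closed_pers_def by blast
qed

lemma Id_on_F_le: "q \<in> Q \<Longrightarrow> Id_on F \<subseteq> q"
  by (simp add: closed_pers_def)

lemma atom_in_mem: "atom_in Q a \<Longrightarrow> a \<in> Q"
  by (simp add: atom_in_def)

lemma atom_iff: "atom_in Q a \<longleftrightarrow> a \<in> Q \<and> a \<noteq> Id_on F \<and> (\<forall>q\<in>Q. q \<subseteq> a \<longrightarrow> q = a \<or> q = Id_on F)"
  unfolding atom_in_def by (simp add: bottom cong: conj_cong ball_cong)

lemma point_le_iff: "q \<in> Q \<Longrightarrow> Id_on (insert x F) \<subseteq> q \<longleftrightarrow> (x, x) \<in> q"
  unfolding closed_pers_def by auto

lemma point_is_atom:
  assumes x: "x \<in> S - F"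
  shows "atom_in Q (Id_on (insert x F))"
  unfolding atom_iff
proof (intro conjI ballI impI)
  show "Id_on (insert x F) \<in> Q"
    using x point_in_Q by blast
  show "Id_on (insert x F) \<noteq> Id_on F"
    using x by auto
  fix q assume q: "q \<in> Q" "q \<subseteq> Id_on (insert x F)"
  show "q = Id_on (insert x F) \<or> q = Id_on F"
  proof (cases "(x, x) \<in> q")
    case True
    then show ?thesis
      using q point_le_iff by blast
  next
    case False
    then have "q \<subseteq> Id_on F"
      using q(2) by auto
    then show ?thesis
      using q(1) unfolding closed_pers_def by blast
  qed
qed

lemma identification_is_atom:
  assumes xy: "x \<in> F" "y \<in> F" "x \<noteq> y"
  shows "atom_in Q (Id_on F \<union> {(x, y), (y, x)})"
  unfolding atom_iff
proof (intro conjI ballI impI)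
  show "Id_on F \<union> {(x, y), (y, x)} \<in> Q"
    using xy by (intro identification_in_Q[OF closed_F _ FS]) auto
  show "Id_on F \<union> {(x, y), (y, x)} \<noteq> Id_on F"
    using xy by auto
  fix q assume q: "q \<in> Q" "q \<subseteq> Id_on F \<union> {(x, y), (y, x)}"
  have F: "Id_on F \<subseteq> q"
    using q(1) unfolding closed_pers_def by blast
  show "q = Id_on F \<union> {(x, y), (y, x)} \<or> q = Id_on F"
  proof (cases "(x, y) \<in> q \<or> (y, x) \<in> q")
    case True
    then have "(x, y) \<in> q" "(y, x) \<in> q"
      using closed_pers_diag(3)[OF q(1)] by blast+
    then show ?thesis
      using F q(2) by blast
  next
    case False
    then show ?thesis
      using F q(2) by blast
  qed
qed

text \<open>Among the atoms, adjoining a point \<open>x\<close> to the domain is distinguished from identifying two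
  points of \<open>F\<close>: the former can be enlarged, by identifying \<open>x\<close> with a point of \<open>F\<close>,
  without any further atom getting below.\<close>

lemma point_atom_iff: "point_atom Q a \<longleftrightarrow> (\<exists>x\<in>S - F. a = Id_on (insert x F))"
proof
  assume "point_atom Q a"
  then obtain c where a: "atom_in Q a" and c: "c \<in> Q" "a \<subset> c"
    and only': "\<forall>b\<in>Q. atom_in Q b \<and> b \<subseteq> c \<longrightarrow> b = a"
    unfolding point_atom_def by (elim conjE bexE)
  have only: "b = a" if "atom_in Q b" "b \<subseteq> c" for b
  proof -
    have "b \<in> Q"
      using that(1) by (rule atom_in_mem)
    then show ?thesis
      using only'[THEN bspec, THEN mp, of b] that by (simp only: simp_thms)
  qed
  show "\<exists>x\<in>S - F. a = Id_on (insert x F)"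
  proof (cases "\<exists>x. x \<notin> F \<and> (x, x) \<in> c")
    case True
    then obtain x where x: "x \<notin> F" "(x, x) \<in> c"
      by blast
    then have xS: "x \<in> S - F"
      using c(1) unfolding closed_pers_def by blast
    then have "Id_on (insert x F) = a"
      using only[OF point_is_atom] point_le_iff[OF c(1)] x by blast
    then show ?thesis
      using xS by blast
  next
    case False
    \<comment> \<open>Now the domain of \<open>c\<close> is \<open>F\<close>, so a pair of
      \<open>c\<close> that is missing from \<open>a\<close> consists of two points of
      \<open>F\<close>, and identifying these gives an atom below \<open>c\<close> other than
      \<open>a\<close>.\<close>
    obtain r s where rs: "(r, s) \<in> c" "(r, s) \<notin> a"
      using c(2) by auto
    have F: "r \<in> F" "s \<in> F"
      using False closed_pers_diag(1,2)[OF c(1) rs(1)] by blast+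
    have Fa: "Id_on F \<subseteq> a" "Id_on F \<subseteq> c"
      using atom_in_mem[OF a] c(1) by (simp_all only: Id_on_F_le)
    then have "r \<noteq> s"
      using rs F by auto
    then have "Id_on F \<union> {(r, s), (s, r)} = a"
      using only[OF identification_is_atom[OF F]] rs(1) closed_pers_diag(3)[OF c(1) rs(1)] Fa(2) by blast
    then show ?thesis
      using rs(2) by blast
  qed
next
  assume "\<exists>x\<in>S - F. a = Id_on (insert x F)"
  then obtain x where x: "x \<in> S" "x \<notin> F" and a: "a = Id_on (insert x F)"
    by blast
  obtain p where p: "p \<in> F"
    using F_nonempty by blast
  let ?c = "Id_on (insert x F) \<union> {(x, p), (p, x)}"
  have c: "?c \<in> Q"
    using x p FS by (intro identification_in_Q closedin_insert) auto
  have "(x, p) \<notin> a"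
    using x p a by auto
  then have less: "a \<subset> ?c"
    unfolding a by blast
  have only: "b = a" if b: "atom_in Q b" "b \<subseteq> ?c" for b
  proof (cases "(x, x) \<in> b")
    case True
    then have "a \<subseteq> b"
      unfolding a using point_le_iff[OF atom_in_mem[OF b(1)]] by simp
    moreover have "atom_in Q a"
      unfolding a using x by (intro point_is_atom) simp
    then have "a \<noteq> Id_on F" "a \<in> Q"
      unfolding atom_iff by (simp_all only: simp_thms)
    moreover have "\<forall>q\<in>Q. q \<subseteq> b \<longrightarrow> q = b \<or> q = Id_on F"
      using b(1) unfolding atom_iff by (elim conjE)
    ultimately show ?thesis
      by metis
  next
    case False
    have bQ: "b \<in> Q"
      using b(1) by (rule atom_in_mem)
    \<comment> \<open>Either pair would put \<open>x\<close> into the domain of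
      \<open>b\<close>.\<close>
    then have "(x, p) \<notin> b" "(p, x) \<notin> b"
      using False closed_pers_diag(1,2)[OF bQ] by blast+
    then have "b \<subseteq> Id_on F"
      using b(2) False by auto
    then have "b = Id_on F"
      using Id_on_F_le[OF bQ] by blast
    moreover have "b \<noteq> Id_on F"
      using b(1) unfolding atom_iff by (elim conjE)
    ultimately show ?thesis
      by (rule notE[rotated])
  qed
  have "atom_in Q a"
    unfolding a using x by (intro point_is_atom) simp
  then show "point_atom Q a"
    unfolding point_atom_def
  proof (intro conjI bexI[OF _ c] ballI impI less)
    fix b assume "atom_in Q b \<and> b \<subseteq> ?c"
    then show "b = a"
      by (elim conjE only)
  qed
qed

text \<open>The point atoms below \<open>q\<close> are the points of its domain outside
  \<open>F\<close>. Domains are closed, being diagonal preimages of closed relations, and every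
  closed set between \<open>F\<close> and \<open>S\<close> is a domain, namely that of its identity
  relation.\<close>

lemma closedin_points_iff:
  "closedin (subtopology K (S - F)) C \<longleftrightarrow> (\<exists>q\<in>Q. C = {x \<in> S - F. Id_on (insert x F) \<subseteq> q})"
proof
  assume "closedin (subtopology K (S - F)) C"
  then obtain C' where C': "closedin K C'" "C = C' \<inter> (S - F)"
    by (auto simp: closedin_subtopology)
  \<comment> \<open>Adjoining \<open>F\<close> makes the identity relation a member of
    \<open>Q\<close> without changing the trace on \<open>S - F\<close>.\<close>
  let ?D = "F \<union> (C' \<inter> S)"
  have "Id_on ?D \<in> Q"
    using C'(1) closed_F closed_S FS by (intro Id_on_in_Q closedin_Un closedin_Int) auto
  moreover have "C = {x \<in> S - F. Id_on (insert x F) \<subseteq> Id_on ?D}"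
    using C'(2) by auto
  ultimately show "\<exists>q\<in>Q. C = {x \<in> S - F. Id_on (insert x F) \<subseteq> q}"
    by blast
next
  assume "\<exists>q\<in>Q. C = {x \<in> S - F. Id_on (insert x F) \<subseteq> q}"
  then obtain q where q: "q \<in> Q" "C = {x \<in> S - F. Id_on (insert x F) \<subseteq> q}"
    by blast
  then have "C = {x \<in> S - F. (x, x) \<in> q}"
    using point_le_iff by simp
  then have "C = {x \<in> topspace K. (x, x) \<in> q} \<inter> (S - F)"
    using SK by blast
  moreover have "closedin (prod_topology K K) q"
    using q(1) by (simp add: closed_pers_def)
  then have "closedin K {x \<in> topspace K. (x, x) \<in> q}"
    by (rule closedin_continuous_map_preimage[rotated]) (simp add: continuous_map_pairedI)
  ultimately show "closedin (subtopology K (S - F)) C"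
    by (auto simp: closedin_subtopology)
qed

end

section \<open>From order isomorphisms to homeomorphisms\<close>

text \<open>An order isomorphism matches point atoms with point atoms, which yields a bijection
  \<open>h\<close> of the underlying points. Closed sets are the sets of point atoms below some
  element, so \<open>h\<close> preserves them in both directions.\<close>

lemma order_iso_imp_homeomorphic:
  fixes K :: "'c topology" and K' :: "'d topology"
  assumes cp: "compact_pair K S F" and cp': "compact_pair K' S' F'"
    and bij: "bij_betw \<psi> (closed_pers K S F) (closed_pers K' S' F')"
    and iso: "\<And>q r. q \<in> closed_pers K S F \<Longrightarrow> r \<in> closed_pers K S F \<Longrightarrow> q \<subseteq> r \<longleftrightarrow> \<psi> q \<subseteq> \<psi> r"
  shows "subtopology K (S - F) homeomorphic_space subtopology K' (S' - F')"
proof -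
  interpret A: compact_pair K S F by fact
  interpret B: compact_pair K' S' F' by fact
  let ?a = "\<lambda>x. Id_on (insert x F)" and ?b = "\<lambda>y. Id_on (insert y F')"
  let ?U = "S - F" and ?V = "S' - F'"
  have aQ: "?a x \<in> A.Q" if "x \<in> ?U" for x
    using that A.point_in_Q by blast
  have bQ: "?b y \<in> B.Q" if "y \<in> ?V" for y
    using that B.point_in_Q by blast
  have inj_b: "y = y'" if "?b y = ?b y'" "y \<in> ?V" "y' \<in> ?V" for y y'
    using that by (auto simp: Id_on_def)
  have inj_a: "x = x'" if "?a x = ?a x'" "x \<in> ?U" "x' \<in> ?U" for x x'
    using that by (auto simp: Id_on_def)
  have \<psi>Q: "\<psi> q \<in> B.Q" if "q \<in> A.Q" for q
    using bij that by (auto simp: bij_betw_def)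
  have \<psi>_inj: "q = r" if "\<psi> q = \<psi> r" "q \<in> A.Q" "r \<in> A.Q" for q r
    using bij that by (auto simp: bij_betw_def inj_on_def)
  have "\<exists>y\<in>?V. \<psi> (?a x) = ?b y" if "x \<in> ?U" for x
  proof -
    have "point_atom A.Q (?a x)"
      using that A.point_atom_iff by blast
    then have "point_atom B.Q (\<psi> (?a x))"
      using point_atom_order_iso[OF bij iso aQ[OF that]] by blast
    then show ?thesis
      using B.point_atom_iff by blast
  qed
  then obtain h where h: "\<And>x. x \<in> ?U \<Longrightarrow> h x \<in> ?V" "\<And>x. x \<in> ?U \<Longrightarrow> \<psi> (?a x) = ?b (h x)"
    by metis
  have onto: "\<exists>x\<in>?U. h x = y" if y: "y \<in> ?V" for y
  proof -
    obtain q where q: "q \<in> A.Q" "\<psi> q = ?b y"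
      using bij bQ[OF y] by (metis bij_betw_imp_surj_on imageE)
    have "point_atom B.Q (?b y)"
      using y B.point_atom_iff by blast
    then have "point_atom A.Q q"
      using point_atom_order_iso[OF bij iso q(1)] q(2) by simp
    then obtain x where x: "x \<in> ?U" "q = ?a x"
      using A.point_atom_iff by blast
    then have "h x = y"
      using inj_b[OF _ h(1)[OF x(1)] y] h(2)[OF x(1)] q(2) by simp
    then show ?thesis
      using x by blast
  qed
  have inj: "inj_on h ?U"
  proof (rule inj_onI)
    fix x x' assume x: "x \<in> ?U" "x' \<in> ?U" "h x = h x'"
    then have "\<psi> (?a x) = \<psi> (?a x')"
      using h(2) by simp
    then show "x = x'"
      using \<psi>_inj[OF _ aQ aQ] inj_a x by blast
  qed
  have le: "?a x \<subseteq> q \<longleftrightarrow> ?b (h x) \<subseteq> \<psi> q" if "x \<in> ?U" "q \<in> A.Q" for x q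
    using iso[OF aQ[OF that(1)] that(2)] h(2)[OF that(1)] by simp
  have topU: "topspace (subtopology K ?U) = ?U" and topV: "topspace (subtopology K' ?V) = ?V"
    using A.SK B.SK by auto
  have surj: "h ` ?U = ?V"
    using h(1) onto by blast
  have "homeomorphic_map (subtopology K ?U) (subtopology K' ?V) h"
  proof (rule bijective_closed_imp_homeomorphic_map)
    show "continuous_map (subtopology K ?U) (subtopology K' ?V) h"
      unfolding continuous_map_closedin topU topV
    proof (intro conjI ballI allI impI)
      fix C assume "closedin (subtopology K' ?V) C"
      then obtain r where r: "r \<in> B.Q" "C = {y \<in> ?V. ?b y \<subseteq> r}"
        unfolding B.closedin_points_iff by blast
      have "r \<in> \<psi> ` A.Q"
        using r(1) bij_betw_imp_surj_on[OF bij] by simp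
      then obtain q where q: "q \<in> A.Q" "r = \<psi> q"
        by blast
      have "{x \<in> ?U. h x \<in> C} = {x \<in> ?U. ?a x \<subseteq> q}"
        unfolding r(2) using h(1) le[OF _ q(1)] q(2) by blast
      then show "closedin (subtopology K ?U) {x \<in> ?U. h x \<in> C}"
        unfolding A.closedin_points_iff using q(1) by blast
    qed (use h(1) in \<open>simp add: Pi_iff\<close>)
    show "closed_map (subtopology K ?U) (subtopology K' ?V) h"
      unfolding closed_map_def
    proof (intro allI impI)
      fix C assume "closedin (subtopology K ?U) C"
      then obtain q where q: "q \<in> A.Q" "C = {x \<in> ?U. ?a x \<subseteq> q}"
        unfolding A.closedin_points_iff by blast
      have "h ` C = {y \<in> ?V. ?b y \<subseteq> \<psi> q}"
      proof (intro set_eqI iffI)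
        fix y assume "y \<in> h ` C"
        then obtain x where x: "x \<in> ?U" "?a x \<subseteq> q" "y = h x"
          unfolding q(2) by blast
        then show "y \<in> {y \<in> ?V. ?b y \<subseteq> \<psi> q}"
          using le[OF x(1) q(1)] h(1) by blast
      next
        fix y assume y: "y \<in> {y \<in> ?V. ?b y \<subseteq> \<psi> q}"
        then obtain x where x: "x \<in> ?U" "h x = y"
          using onto by blast
        then have "x \<in> C"
          unfolding q(2) using le[OF x(1) q(1)] y by blast
        then show "y \<in> h ` C"
          using x(2) by blast
      qed
      then show "closedin (subtopology K' ?V) (h ` C)"
        unfolding B.closedin_points_iff using \<psi>Q[OF q(1)] by blast
    qed
    show "h ` topspace (subtopology K ?U) = topspace (subtopology K' ?V)"
      unfolding topU topV by (rule surj)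
    show "inj_on h (topspace (subtopology K ?U))"
      unfolding topU by (rule inj)
  qed
  then show ?thesis
    by (rule homeomorphic_map_imp_homeomorphic_space)
qed

text \<open>Elements with equal \<open>f\<close>-values satisfy both inclusions, and
  \<open>iso\<close> turns these into equal \<open>g\<close>-values. Hence \<psi> does not depend on
  the preimage picked by \<open>inv_into\<close>; its injectivity is antisymmetry of
  inclusion.\<close>

lemma order_iso_of_surjections:
  assumes \<phi>: "bij_betw \<phi> A B" and f: "f ` A = Q" and g: "g ` B = R"
    and iso: "\<And>a a'. a \<in> A \<Longrightarrow> a' \<in> A \<Longrightarrow> f a \<subseteq> f a' \<longleftrightarrow> g (\<phi> a) \<subseteq> g (\<phi> a')"
  obtains \<psi> where "bij_betw \<psi> Q R" "\<forall>q\<in>Q. \<forall>r\<in>Q. q \<subseteq> r \<longleftrightarrow> \<psi> q \<subseteq> \<psi> r"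
proof -
  define s where "s = inv_into A f"
  have s: "s q \<in> A" "f (s q) = q" if "q \<in> Q" for q
    using that unfolding f[symmetric] s_def by (simp_all only: inv_into_into f_inv_into_f)
  define \<psi> where "\<psi> = (\<lambda>q. g (\<phi> (s q)))"
  have \<psi>_iso: "q \<subseteq> r \<longleftrightarrow> \<psi> q \<subseteq> \<psi> r" if "q \<in> Q" "r \<in> Q" for q r
    using iso[OF s(1)[OF that(1)] s(1)[OF that(2)]] s(2)[OF that(1)] s(2)[OF that(2)]
    by (simp add: \<psi>_def)
  have \<psi>f: "\<psi> (f a) = g (\<phi> a)" if a: "a \<in> A" for a
  proof -
    have fa: "f a \<in> Q"
      using a f by blast
    show ?thesis
      unfolding \<psi>_def using iso[OF s(1)[OF fa] a] iso[OF a s(1)[OF fa]] s(2)[OF fa] by auto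
  qed
  have "inj_on \<psi> Q"
  proof (rule inj_onI)
    fix q r assume "q \<in> Q" "r \<in> Q" "\<psi> q = \<psi> r"
    then show "q = r"
      using \<psi>_iso[of q r] \<psi>_iso[of r q] by (intro antisym) simp_all
  qed
  moreover have "\<psi> ` Q = R"
  proof -
    have "\<psi> ` Q = (\<lambda>a. g (\<phi> a)) ` A"
      unfolding f[symmetric] image_image using \<psi>f by (intro image_cong) auto
    also have "\<dots> = g ` \<phi> ` A"
      by (simp add: image_image)
    also have "\<dots> = R"
      using \<phi> g by (simp add: bij_betw_def)
    finally show ?thesis .
  qed
  ultimately show ?thesis
    using that \<psi>_iso by (simp add: bij_betw_def)
qed

section \<open>The poset of extensions\<close>

context non_P_space
begin

lemma compact_pair_remainder: "compact_pair K remainder core"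
  using Hausdorff_K closedin_remainder closedin_core core_subset_remainder core_nonempty
  by unfold_locales

lemma remainder_minus_core: "remainder - core = lambdaP P X K e - e ` topspace X"
  using openin_subset[OF openin_lambda] by (auto simp: remainder_def core_def)

text \<open>The description is proper: presentations exist by \<open>ex_presents\<close>, and they
  share one kernel by \<open>presents_kernel_unique\<close>.\<close>

definition kernel :: "('a + 'a set set) topology \<Rightarrow> 'c rel" where
  "kernel T = (THE E. \<exists>Z \<phi>. presents Inl T Z \<phi> \<and> E = remainder_kernel Z \<phi>)"

lemma kernel_eq:
  assumes "presents Inl T Z \<phi>"
  shows "kernel T = remainder_kernel Z \<phi>"
  unfolding kernel_def
proof (rule the_equality)
  show "\<exists>Z' \<phi>'. presents Inl T Z' \<phi>' \<and> remainder_kernel Z \<phi> = remainder_kernel Z' \<phi>'"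
    using assms by (intro exI[of _ Z] exI[of _ \<phi>]) simp
  fix E assume "\<exists>Z \<phi>. presents Inl T Z \<phi> \<and> E = remainder_kernel Z \<phi>"
  then obtain Z' \<phi>' where "presents Inl T Z' \<phi>'" "E = remainder_kernel Z' \<phi>'"
    by (elim exE conjE)
  then show "E = remainder_kernel Z \<phi>"
    using presents_kernel_unique[OF assms] by simp
qed

lemma is_extensionD:
  assumes "is_extension X T"
  shows "tychonoff T" "embedding_map X T Inl" "T closure_of (Inl ` topspace X) = topspace T"
  using assms by (simp_all add: is_extension_def)

lemma ext_le_iff:
  assumes T: "is_extension X T" and T': "is_extension X T'"
  shows "ext_le X T T' \<longleftrightarrow> kernel T' \<subseteq> kernel T"
proof -
  obtain Z \<phi> where pr: "presents Inl T Z \<phi>"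
    using is_extensionD[OF T] by (rule ex_presents)
  obtain Z' \<phi>' where pr': "presents Inl T' Z' \<phi>'"
    using is_extensionD[OF T'] by (rule ex_presents)
  show ?thesis
    unfolding ext_le_def kernel_eq[OF pr] kernel_eq[OF pr']
    by (rule presents_le_iff[OF pr pr' is_extensionD(2)[OF T']])
qed

text \<open>Inverse invariance lifts \<open>P\<close> from \<open>T\<close> to the presenting
  subspace \<open>Z\<close>, and \<open>core_subset_if_hasP\<close> then places \<open>core\<close>
  in the domain of the kernel. The compact remainder of \<open>T\<close> makes the kernel
  closed.\<close>

lemma kernel_in_closed_pers:
  assumes "T \<in> ext_P P X"
  shows "kernel T \<in> closed_pers K remainder core"
proof -
  have T: "is_extension X T" "hasP P T" "compactin T (topspace T - Inl ` topspace X)"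
    using assms by (simp_all add: ext_P_def)
  note T' = is_extensionD[OF T(1)]
  obtain Z \<phi> where pr: "presents Inl T Z \<phi>"
    using T' by (rule ex_presents)
  then have ZK: "e ` topspace X \<subseteq> Z" "Z \<subseteq> topspace K" and perf: "perfect_map (subtopology K Z) T \<phi>"
    by (auto simp: presents_def)
  let ?D = "Z - e ` topspace X"
  have "closedin K ?D"
    using compactin_remainder[OF pr T'(2) T(3)] Hausdorff_K compactin_imp_closedin by blast
  moreover have "?D \<subseteq> remainder"
    using ZK by (auto simp: remainder_def)
  moreover have "hasP P (subtopology K Z)"
    using hasP_perfect[OF tychonoff_subtopology[OF tychonoff_K] T'(1) perf small_subtopology] T(2) by simp
  moreover have "e ` topspace X \<union> ?D = Z"
    using ZK by blast
  ultimately have "core \<subseteq> ?D"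
    using core_subset_if_hasP by simp
  then have "Id_on core \<subseteq> remainder_kernel Z \<phi>"
    by (auto simp: remainder_kernel_def)
  moreover have "remainder_kernel Z \<phi> \<subseteq> remainder \<times> remainder"
    using ZK by (auto simp: remainder_kernel_def remainder_def)
  moreover have "sym (remainder_kernel Z \<phi>)" "trans (remainder_kernel Z \<phi>)"
    by (auto simp: remainder_kernel_def sym_def trans_def)
  moreover have "closedin (prod_topology K K) (remainder_kernel Z \<phi>)"
    using T'(1) by (intro closedin_remainder_kernel[OF pr T'(2) _ T(3)]) (simp add: tychonoff_def)
  ultimately show ?thesis
    unfolding kernel_eq[OF pr] closed_pers_def by simp
qed

text \<open>Here \<open>P\<close> travels the other way: the subspace over the domain of
  \<open>E\<close> has \<open>P\<close> by \<open>hasP_if_core_subset\<close>, and its perfect image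
  inherits it.\<close>

lemma ex_ext_with_kernel:
  assumes "E \<in> closed_pers K remainder core"
  obtains T where "T \<in> ext_P P X" "kernel T = E"
proof -
  have E: "closedin (prod_topology K K) E" "sym E" "trans E" "E \<subseteq> remainder \<times> remainder" "Id_on core \<subseteq> E"
    using assms by (simp_all add: closed_pers_def)
  let ?D = "{u. (u, u) \<in> E}"
  let ?Z = "e ` topspace X \<union> ?D"
  obtain T \<phi> where T: "is_extension X T" "presents Inl T ?Z \<phi>" "remainder_kernel ?Z \<phi> = E"
    "compactin T (topspace T - Inl ` topspace X)" "topspace T - Inl ` topspace X = \<phi> ` ?D"
    by (rule ex_extension_with_kernel[OF E(1) E(4)[unfolded remainder_def] E(2,3)])
  note T' = is_extensionD[OF T(1)]
  have D: "?D \<subseteq> remainder"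
    using E(4) by blast
  then have "?Z - e ` topspace X = ?D"
    by (auto simp: remainder_def)
  then have "compactin K ?D"
    using compactin_remainder[OF T(2) T'(2) T(4)] by simp
  then have "closedin K ?D"
    using Hausdorff_K compactin_imp_closedin by blast
  moreover have "core \<subseteq> ?D"
    using E(5) by auto
  ultimately have "hasP P (subtopology K ?Z)"
    using D by (intro hasP_if_core_subset)
  moreover have "perfect_map (subtopology K ?Z) T \<phi>"
    using T(2) by (simp add: presents_def)
  ultimately have "hasP P T"
    using hasP_perfect[OF tychonoff_subtopology[OF tychonoff_K] T'(1) _ small_subtopology] by simp
  then have "T \<in> ext_P P X"
    using T by (simp add: ext_P_def)
  moreover have "kernel T = E"
    using kernel_eq[OF T(2)] T(3) by simp
  ultimately show ?thesis
    by (rule that)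
qed

text \<open>A homeomorphism over \<open>X\<close> and its inverse give both inequalities, hence both
  inclusions of kernels.\<close>

lemma ext_equiv_kernel:
  assumes T: "T \<in> ext_P P X" and T': "T' \<in> ext_P P X" and eq: "ext_equiv X T T'"
  shows "kernel T' = kernel T"
proof -
  obtain h where h: "homeomorphic_map T T' h" "\<And>x. x \<in> topspace X \<Longrightarrow> h (Inl x) = Inl x"
    using eq unfolding ext_equiv_def by blast
  obtain k where k: "homeomorphic_maps T T' h k"
    using h(1) unfolding homeomorphic_map_maps by blast
  have ext: "is_extension X T" "is_extension X T'"
    using T T' by (simp_all add: ext_P_def)
  have "ext_le X T' T"
    unfolding ext_le_def using h(2) homeomorphic_imp_continuous_map[OF h(1)] by blast
  moreover have "k (Inl x) = Inl x" if "x \<in> topspace X" for x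
  proof -
    have "Inl x \<in> topspace T"
      using ext(1) that unfolding is_extension_def by blast
    then have "k (h (Inl x)) = Inl x"
      using k by (simp add: homeomorphic_maps_def)
    then show ?thesis
      using h(2)[OF that] by simp
  qed
  then have "ext_le X T T'"
    unfolding ext_le_def using k unfolding homeomorphic_maps_def by blast
  ultimately show ?thesis
    using ext_le_iff[OF ext] ext_le_iff[OF ext(2,1)] by blast
qed

definition class_kernel :: "('a + 'a set set) topology set \<Rightarrow> 'c rel" where
  "class_kernel c = kernel (SOME T. T \<in> c)"

lemma class_kernel_eq:
  assumes c: "c \<in> E_P P X" and T: "T \<in> c"
  shows "T \<in> ext_P P X" "class_kernel c = kernel T"
proof -
  obtain T0 where T0: "T0 \<in> ext_P P X" "c = {T' \<in> ext_P P X. ext_equiv X T0 T'}"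
    using c unfolding E_P_def by blast
  have *: "T' \<in> ext_P P X" "kernel T' = kernel T0" if "T' \<in> c" for T'
    using that T0 ext_equiv_kernel[OF T0(1)] by auto
  show "T \<in> ext_P P X"
    using *(1) T by blast
  have "(SOME T. T \<in> c) \<in> c"
    using T by (rule someI)
  then show "class_kernel c = kernel T"
    unfolding class_kernel_def using *(2) T by simp
qed

lemma E_P_nonempty:
  assumes "c \<in> E_P P X"
  obtains T where "T \<in> c"
proof -
  obtain T where T: "T \<in> ext_P P X" "c = {T' \<in> ext_P P X. ext_equiv X T T'}"
    using assms unfolding E_P_def by blast
  have "ext_equiv X T T"
    unfolding ext_equiv_def by (rule exI[of _ id]) simp
  then show ?thesis
    using T that by blast
qed

lemma class_kernel_image: "class_kernel ` E_P P X = closed_pers K remainder core"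
proof (intro antisym subsetI)
  fix E assume "E \<in> class_kernel ` E_P P X"
  then obtain c where c: "c \<in> E_P P X" "E = class_kernel c"
    by blast
  then show "E \<in> closed_pers K remainder core"
    using E_P_nonempty[OF c(1)] class_kernel_eq[OF c(1)] kernel_in_closed_pers by metis
next
  fix E assume "E \<in> closed_pers K remainder core"
  then obtain T where T: "T \<in> ext_P P X" "kernel T = E"
    by (rule ex_ext_with_kernel)
  let ?c = "{T' \<in> ext_P P X. ext_equiv X T T'}"
  have c: "?c \<in> E_P P X"
    using T(1) unfolding E_P_def by blast
  have "ext_equiv X T T"
    unfolding ext_equiv_def by (rule exI[of _ id]) simp
  then have "class_kernel ?c = E"
    using class_kernel_eq(2)[OF c, of T] T by simp
  then show "E \<in> class_kernel ` E_P P X"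
    using c by blast
qed

lemma E_le_iff:
  assumes c: "c \<in> E_P P X" and c': "c' \<in> E_P P X"
  shows "E_le X c c' \<longleftrightarrow> class_kernel c' \<subseteq> class_kernel c"
proof -
  have *: "ext_le X T T' \<longleftrightarrow> class_kernel c' \<subseteq> class_kernel c" if "T \<in> c" "T' \<in> c'" for T T'
    using class_kernel_eq[OF c that(1)] class_kernel_eq[OF c' that(2)] ext_le_iff[of T T']
    by (simp add: ext_P_def)
  obtain T T' where "T \<in> c" "T' \<in> c'"
    using E_P_nonempty[OF c] E_P_nonempty[OF c'] by metis
  then show ?thesis
    unfolding E_le_def using * by blast
qed

end

theorem theorem4p13:
  fixes P :: "'u topology \<Rightarrow> bool"
    and X :: "'a topology" and Y :: "'b topology"
    and KX :: "'c topology" and eX :: "'a \<Rightarrow> 'c"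
    and KY :: "'d topology" and eY :: "'b \<Rightarrow> 'd"
  assumes universe: "\<exists>j :: ('a + 'b + real) set set set \<Rightarrow> 'u. inj j"
    and P: "compactness_like P"
    and X: "tychonoff X" "locally_compact_space X" "locally_P P X" "\<not> hasP P X"
    and Y: "tychonoff Y" "locally_compact_space Y" "locally_P P Y" "\<not> hasP P Y"
    and betaX: "stone_cech X KX eX"
    and betaY: "stone_cech Y KY eY"
    and iso: "order_isomorphic_E P X Y"
  shows "subtopology KX (lambdaP P X KX eX - eX ` topspace X) homeomorphic_space
         subtopology KY (lambdaP P Y KY eY - eY ` topspace Y)"
proof -
  let ?V = "UNIV :: ('a + 'b + real) set set set set"
  have V: "?V \<lesssim> (UNIV :: 'u set)"
    using universe by (auto simp: lepoll_def)
  \<comment> \<open>The summand \<open>real\<close> in the size assumption guarantees an infinite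
    universe.\<close>
  have "inj (\<lambda>x :: real. {{{Inr (Inr x)}}} :: ('a + 'b + real) set set set)"
    by (auto simp: inj_def)
  then have "(UNIV :: real set) \<lesssim> ?V"
    unfolding lepoll_def by blast
  then have "(UNIV :: real set) \<lesssim> (UNIV :: 'u set)"
    using V lepoll_trans by blast
  then have inf: "infinite (UNIV :: 'u set)"
    unfolding lepoll_def using infinite_UNIV_char_0 inj_on_finite by blast
  have small: "(UNIV :: 'v set set set) \<lesssim> (UNIV :: 'u set)"
    if "inj i" for i :: "'v \<Rightarrow> 'a + 'b + real"
  proof -
    \<comment> \<open>Taking images under \<open>i\<close> moves a family of sets to the larger base
      type; the outer singleton supplies the third power set level.\<close>
    have "inj (\<lambda>\<A>. {image i ` \<A>})"
      using that by (auto simp: inj_def inj_image_eq_iff)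
    then have "(UNIV :: 'v set set set) \<lesssim> ?V"
      unfolding lepoll_def by blast
    then show ?thesis
      using V lepoll_trans by blast
  qed
  have smallX: "topspace KX \<lesssim> (UNIV :: 'u set)"
    using lepoll_trans[OF stone_cech_space.topspace_lepoll[OF stone_cech_space.intro[OF betaX]]
        small[of Inl]] by simp
  have smallY: "topspace KY \<lesssim> (UNIV :: 'u set)"
    using lepoll_trans[OF stone_cech_space.topspace_lepoll[OF stone_cech_space.intro[OF betaY]]
        small[of "\<lambda>y. Inr (Inl y)"]] by (simp add: inj_def)
  interpret A: non_P_space P X KX eX
    using P inf betaX X smallX by unfold_locales
  interpret B: non_P_space P Y KY eY
    using P inf betaY Y smallY by unfold_locales
  obtain \<phi> where \<phi>: "bij_betw \<phi> (E_P P X) (E_P P Y)"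
    and \<phi>_iso: "\<And>c c'. c \<in> E_P P X \<Longrightarrow> c' \<in> E_P P X \<Longrightarrow> E_le X c c' \<longleftrightarrow> E_le Y (\<phi> c) (\<phi> c')"
    using iso unfolding order_isomorphic_E_def by blast
  have \<phi>E: "\<phi> c \<in> E_P P Y" if "c \<in> E_P P X" for c
    using \<phi> that by (auto simp: bij_betw_def)
  \<comment> \<open>Passing to kernels reverses the order for \<open>X\<close> and for
    \<open>Y\<close> alike, so inclusion of kernels corresponds to inclusion of kernels, with
    \<open>c\<close> and \<open>c'\<close> exchanged in the order of extensions.\<close>
  have kernel_iso: "A.class_kernel c \<subseteq> A.class_kernel c' \<longleftrightarrow> B.class_kernel (\<phi> c) \<subseteq> B.class_kernel (\<phi> c')"
    if "c \<in> E_P P X" "c' \<in> E_P P X" for c c'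
    using \<phi>_iso[OF that(2,1)] A.E_le_iff[OF that(2,1)] B.E_le_iff[OF \<phi>E \<phi>E, OF that(2,1)] by simp
  obtain \<psi> where \<psi>: "bij_betw \<psi> (closed_pers KX A.remainder A.core) (closed_pers KY B.remainder B.core)"
    and \<psi>_iso: "\<forall>q\<in>closed_pers KX A.remainder A.core. \<forall>r\<in>closed_pers KX A.remainder A.core.
      q \<subseteq> r \<longleftrightarrow> \<psi> q \<subseteq> \<psi> r"
    by (rule order_iso_of_surjections[OF \<phi> A.class_kernel_image B.class_kernel_image kernel_iso])
  have "subtopology KX (A.remainder - A.core) homeomorphic_space
        subtopology KY (B.remainder - B.core)"
    using A.compact_pair_remainder B.compact_pair_remainder \<psi> \<psi>_iso[rule_format]
    by (rule order_iso_imp_homeomorphic)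
  then show ?thesis
    unfolding A.remainder_minus_core B.remainder_minus_core .
qed

end
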